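(* Let $A$, $B$ and $\mathbb{X}$ be positive stable matrices in $\mathbb{C}^{r\times r}$, with $B\mathbb{X}=\mathbb{X}B$, and let $\lambda,\mu\in\mathbb{C}$ be such that $\Re(\mu)>\Re(\lambda)>0$. Then, for $|z|<|1-t|$, $$\sum_{n=0}^{\infty}\frac{(A)_{n}}{n!}\,F^{(\mathbb{X})}(A+nI,B;B+(\mu-\lambda)I;z)\,t^{n}=(1-t)^{-A}\,F^{(\mathbb{X})}\Big(A,B;B+(\mu-\lambda)I;\frac{z}{1-t}\Big).$$
   Context: $\mathbb{C}^{r\times r}$ is the space of complex $r\times r$ matrices and $I$ is the identity; $z,t$ are complex variables. A matrix is positive stable if all its eigenvalues have positive real part. Matrix powers are $t^{M}=\exp(M\log t)$; in particular $(1-s)^{-M}=\sum_{n\ge0}(M)_n\frac{s^n}{n!}$ for $|s|<1$. For positive stable $M$, $\Gamma(M)=\int_0^\infty e^{-t}t^{M-I}dt$, and $\Gamma^{-1}(M)$ is its inverse. The Pochhammer symbol is $(M)_0=I$, $(M)_n=M(M+I)\cdots(M+(n-1)I)$ for $n\ge1$. Extended beta matrix function: for commuting positive stable matrices $P,Q,\mathbb{X}$, $$\mathfrak{B}(P,Q;\mathbb{X})=\int_0^1 t^{P-I}(1-t)^{Q-I}\exp\Big(\frac{-\mathbb{X}}{t(1-t)}\Big)dt.$$ Extended Gauss hypergeometric matrix function: for positive stable $P,Q,R,R-Q,\mathbb{X}$ with $Q,R,\mathbb{X}$ commuting with each other, $$F^{(\mathbb{X})}(P,Q;R;z)=\lef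t(\sum_{m\ge0}(P)_m\,\mathfrak{B}(Q+mI,R-Q;\mathbb{X})\frac{z^m}{m!}\right)\Gamma(R)\Gamma^{-1}(Q)\Gamma^{-1}(R-Q).$$
   Formalization: The identity, including convergence of the series, is proved under the extra conditions |z|<1, |t|<1 and |t|<|1-z|, without which the left side can diverge (e.g. r=1, z=0.9, t=-0.9); boundary cases of these conditions are not covered. *)

theory Defs
  imports "HOL-Analysis.Analysis"
begin

(* Square matrices of size r are elements of complex^'r^'r with CARD('r) = r.  On this type the
   operations "times", "1" and "power" of the type classes are componentwise, so matrix products
   are written with "**", the identity is "mat 1", and "mat c" is c I (hence "mat c ** M" is c M). *)

definition mat_eigenvalue :: "complex^'r^'r \<Rightarrow> complex \<Rightarrow> bool" where
  "mat_eigenvalue M c \<longleftrightarrow> (\<exists>v. v \<noteq> 0 \<and> M *v v = c *s v)"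

definition positive_stable :: "complex^'r^'r \<Rightarrow> bool" where
  "positive_stable M \<longleftrightarrow> (\<forall>c. mat_eigenvalue M c \<longrightarrow> Re c > 0)"

primrec mat_power :: "complex^'r^'r \<Rightarrow> nat \<Rightarrow> complex^'r^'r" where
  "mat_power M 0 = mat 1"
| "mat_power M (Suc n) = mat_power M n ** M"

definition mat_exp :: "complex^'r^'r \<Rightarrow> complex^'r^'r" where
  "mat_exp M = (\<Sum>n. (1 / fact n) *\<^sub>R mat_power M n)"

(* Principal branch; for real t > 0 this is the real logarithm. *)
definition mat_cpow :: "complex \<Rightarrow> complex^'r^'r \<Rightarrow> complex^'r^'r" where
  "mat_cpow t M = mat_exp (mat (Ln t) ** M)"

primrec mat_pochhammer :: "complex^'r^'r \<Rightarrow> nat \<Rightarrow> complex^'r^'r" where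
  "mat_pochhammer M 0 = mat 1"
| "mat_pochhammer M (Suc n) = mat_pochhammer M n ** (M + mat (of_nat n))"

definition mat_Gamma :: "complex^'r^'r \<Rightarrow> complex^'r^'r" where
  "mat_Gamma M = (LBINT t:{0<..}. exp (- t) *\<^sub>R mat_cpow (complex_of_real t) (M - mat 1))"

definition ext_Beta :: "complex^'r^'r \<Rightarrow> complex^'r^'r \<Rightarrow> complex^'r^'r \<Rightarrow> complex^'r^'r" where
  "ext_Beta P Q X = (LBINT t:{0<..<1}.
     mat_cpow (complex_of_real t) (P - mat 1)
       ** mat_cpow (complex_of_real (1 - t)) (Q - mat 1)
       ** mat_exp ((- 1 / (t * (1 - t))) *\<^sub>R X))"

(* ext_Gauss X P Q R z is the extended Gauss function with upper parameters P, Q, lower parameter R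
   and extension parameter X.  It is used for positive stable P, Q, R, R - Q, X with Q, R, X
   commuting, and inside the unit disc of z, where its defining series converges. *)
definition ext_Gauss ::
  "complex^'r^'r \<Rightarrow> complex^'r^'r \<Rightarrow> complex^'r^'r \<Rightarrow> complex^'r^'r \<Rightarrow> complex \<Rightarrow> complex^'r^'r" where
  "ext_Gauss X P Q R z =
     (\<Sum>m. mat (z ^ m / fact m) ** (mat_pochhammer P m ** ext_Beta (Q + mat (of_nat m)) (R - Q) X))
       ** mat_Gamma R ** matrix_inv (mat_Gamma Q) ** matrix_inv (mat_Gamma (R - Q))"

end

theory Submission
  imports Defs "HOL-Complex_Analysis.Conformal_Mappings"
    "HOL-Computational_Algebra.Fundamental_Theorem_Algebra"
begin

text \<open>
  Write \<open>W\<close> for the integrand of the extended beta function and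
  \<open>\<Phi> P z = \<Sum>m. (P)\<^sub>m \<BB>(B + m I, \<dots>) z ^ m / m!\<close> for the Gauss function without its constant
  right factor. The contiguous relation \<open>P \<Phi>(P) + w \<Phi>'(P) = P \<Phi>(P + I)\<close> says that
  \<open>V P t = (1 - t) ^ (- P) \<Phi> P (z / (1 - t))\<close> satisfies \<open>V' P = P V (P + I)\<close>, so the series on the
  left is the Taylor series of \<open>V A\<close> at \<open>0\<close>; this settles small \<open>t\<close>.

  For the remaining \<open>t\<close> the Taylor series must be shown to converge for
  \<open>\<bar>t\<bar> < min 1 \<bar>1 - z\<bar>\<close>; the identity theorem then gives the value. Since \<open>W\<close> is integrable (here
  the positive stability of \<open>X\<close> enters, through exponential decay of \<open>exp (- u X)\<close>),
  \<open>\<Phi> (A + n I) z = \<integral> (1 - z s) ^ (- A - n I) W s ds\<close> over \<open>(0,1)\<close>. On the segment \<open>\<bar>1 - z s\<bar>\<close> may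
  well be smaller than \<open>\<bar>1 - z\<bar>\<close> and \<open>1\<close>, but the integrand is holomorphic and the path can be
  moved away from \<open>1 / z\<close>, leaving only the two end points as obstruction.
\<close>

subsection \<open>Matrix algebra\<close>

lemma mat_mult_nth [simp]: "(mat c ** M) $ i $ j = c * M $ i $ j"
  for M :: "complex^'r^'r"
proof -
  have "(mat c ** M) $ i $ j = (\<Sum>k\<in>UNIV. if i = k then c * M $ k $ j else 0)"
    by (simp add: matrix_matrix_mult_def mat_def if_distrib if_distribR cong: if_cong)
  then show ?thesis by simp
qed

lemma mat_0_mult: "mat 0 ** M = 0" for M :: "complex^'r^'r"
  by (simp add: vec_eq_iff)

lemma mult_mat_commute: "M ** mat c = mat c ** M"
  for M :: "complex^'r^'r"
proof -
  have "(M ** mat c) $ i $ j = c * M $ i $ j" for i j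
  proof -
    have "(M ** mat c) $ i $ j = (\<Sum>k\<in>UNIV. if k = j then M $ i $ k * c else 0)"
      by (simp add: matrix_matrix_mult_def mat_def if_distrib if_distribR cong: if_cong)
    then show ?thesis by simp
  qed
  then show ?thesis by (simp add: vec_eq_iff)
qed

lemma mat_mult_mat_assoc: "mat a ** (mat b ** M) = mat (a * b) ** M"
  for M :: "complex^'r^'r"
  by (simp add: vec_eq_iff)

lemma mat_add: "mat (a + b) = mat a + (mat b :: complex^'r^'r)"
  by (simp add: vec_eq_iff mat_def)

lemma matrix_mult_mat_left: "M ** (mat c ** N) = mat c ** (M ** N)"
  for M N :: "complex^'r^'r"
  by (simp add: matrix_mul_assoc mult_mat_commute[of M])

lemma mat_mult_mult_mat_mult: "(mat a ** M) ** (mat b ** N) = mat (a * b) ** (M ** N)"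
  for M N :: "complex^'r^'r"
proof -
  have "(mat a ** M) ** (mat b ** N) = mat b ** (mat a ** (M ** N))"
    by (simp only: matrix_mult_mat_left[of "mat a ** M"] matrix_mul_assoc[of "mat a" M N])
  then show ?thesis by (simp add: mat_mult_mat_assoc mult.commute)
qed

lemma scaleR_eq_mat_mult: "r *\<^sub>R M = mat (of_real r) ** M"
  for M :: "complex^'r^'r"
  by (auto simp: vec_eq_iff) (simp add: scaleR_conv_of_real)

lemma mat_vector_mult_eq: "mat c *v v = c *s (v :: complex^'r)"
proof -
  have "(mat c *v v) $ i = (\<Sum>k\<in>UNIV. if i = k then c * v $ k else 0)" for i
    by (simp add: matrix_vector_mult_def mat_def if_distrib if_distribR cong: if_cong)
  then show ?thesis by (simp add: vec_eq_iff)
qed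

lemma bounded_bilinear_matrix_mult:
  "bounded_bilinear ((**) :: complex^'r^'r \<Rightarrow> complex^'r^'r \<Rightarrow> complex^'r^'r)"
  unfolding bilinear_conv_bounded_bilinear[symmetric]
  by (auto simp: bilinear_def linear_iff matrix_add_ldistrib vec_eq_iff
      matrix_matrix_mult_def sum.distrib scaleR_sum_right algebra_simps)

lemma matrix_add_rdistrib: "(A + B) ** C = A ** C + B ** C"
  for A B C :: "complex^'r^'r"
  using bounded_bilinear.add_left[OF bounded_bilinear_matrix_mult] .

lemma norm_matrix_mult_bound:
  obtains K where "K > 0" "\<And>(A :: complex^'r^'r) (B :: complex^'r^'r). norm (A ** B) \<le> K * norm A * norm B"
proof -
  obtain K where "K > 0"
      "\<forall>(A :: complex^'r^'r) (B :: complex^'r^'r). norm (A ** B) \<le> norm A * norm B * K"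
    using bounded_bilinear.pos_bounded[OF bounded_bilinear_matrix_mult] by blast
  then show ?thesis
    by (intro that[of K]) (auto simp: mult_ac)
qed

lemma norm_mat_mult: "norm (mat c ** M) = norm c * norm M"
  for M :: "complex^'r^'r"
  by (simp add: norm_vec_def norm_mult L2_set_right_distrib)

lemma norm_entry_le: "norm (M $ i $ j) \<le> norm M"
  for M :: "complex^'r^'r"
  by (rule order_trans[OF Finite_Cartesian_Product.norm_nth_le Finite_Cartesian_Product.norm_nth_le])

lemma vec_sums_iff: "f sums S \<longleftrightarrow> (\<forall>i. (\<lambda>n. f n $ i) sums S $ i)"
  for f :: "nat \<Rightarrow> ('a::real_normed_vector)^'r"
  unfolding sums_def
  by (auto simp flip: sum_component intro: vec_tendstoI dest: tendsto_vec_nth)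

lemma matrix_sums_iff: "f sums S \<longleftrightarrow> (\<forall>i j. (\<lambda>n. f n $ i $ j) sums S $ i $ j)"
  for f :: "nat \<Rightarrow> complex^'r^'r"
  by (subst vec_sums_iff, subst vec_sums_iff) simp

subsection \<open>Entrywise complex derivatives\<close>

definition has_mat_deriv ::
    "(complex \<Rightarrow> complex^'r^'r) \<Rightarrow> complex^'r^'r \<Rightarrow> complex \<Rightarrow> bool" where
  "has_mat_deriv f D a \<longleftrightarrow>
     (\<forall>i j. ((\<lambda>s. f s $ i $ j) has_field_derivative D $ i $ j) (at a))"

lemma has_mat_deriv_const: "has_mat_deriv (\<lambda>_. C) 0 a"
  by (simp add: has_mat_deriv_def)

lemma has_mat_deriv_mult:
  assumes "has_mat_deriv f F a" "has_mat_deriv g G a"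
  shows "has_mat_deriv (\<lambda>s. f s ** g s) (F ** g a + f a ** G) a"
proof -
  have "((\<lambda>s. \<Sum>k\<in>UNIV. f s $ i $ k * g s $ k $ j) has_field_derivative
      (\<Sum>k\<in>UNIV. F $ i $ k * g a $ k $ j + f a $ i $ k * G $ k $ j)) (at a)" for i j
    by (rule DERIV_sum, rule derivative_eq_intros)
      (use assms in \<open>auto simp: has_mat_deriv_def\<close>)
  then show ?thesis
    by (simp add: has_mat_deriv_def matrix_matrix_mult_def sum.distrib)
qed

lemma has_mat_deriv_cmult:
  assumes "has_mat_deriv g G a"
  shows "has_mat_deriv (\<lambda>s. C ** g s) (C ** G) a"
proof -
  have "0 ** g a + C ** G = C ** G" by (simp add: vec_eq_iff matrix_matrix_mult_def)
  then show ?thesis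
    using has_mat_deriv_mult[OF has_mat_deriv_const assms, of C] by simp
qed

lemma has_mat_deriv_mat:
  assumes "(c has_field_derivative D) (at a)"
  shows "has_mat_deriv (\<lambda>s. mat (c s)) (mat D) a"
  using assms by (auto simp: has_mat_deriv_def mat_def)

lemma has_mat_deriv_scalar_mult:
  assumes "(c has_field_derivative D) (at a)" "has_mat_deriv g G a"
  shows "has_mat_deriv (\<lambda>s. mat (c s) ** g s) (mat D ** g a + mat (c a) ** G) a"
  using has_mat_deriv_mult[OF has_mat_deriv_mat] assms by blast

lemma has_mat_deriv_chain:
  assumes "has_mat_deriv f F (g a)" "(g has_field_derivative D) (at a)"
  shows "has_mat_deriv (\<lambda>s. f (g s)) (mat D ** F) a"
  using assms DERIV_chain2[of "\<lambda>s. f s $ i $ j" "F $ i $ j" g a D UNIV for i j]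
  by (auto simp: has_mat_deriv_def mult.commute)

lemma has_mat_deriv_imp_holomorphic:
  assumes "\<And>s. s \<in> S \<Longrightarrow> has_mat_deriv f (F s) s"
  shows "(\<lambda>s. f s $ i $ j) holomorphic_on S"
  unfolding holomorphic_on_def
proof
  fix s assume "s \<in> S"
  then have "(\<lambda>s. f s $ i $ j) field_differentiable at s"
    using assms unfolding field_differentiable_def has_mat_deriv_def by blast
  then show "(\<lambda>s. f s $ i $ j) field_differentiable at s within S"
    by (rule field_differentiable_at_within)
qed

lemma has_mat_deriv_taylor:
  fixes D :: "nat \<Rightarrow> complex \<Rightarrow> complex^'r^'r"
  assumes D: "\<And>n s. s \<in> ball a r \<Longrightarrow> has_mat_deriv (D n) (D (Suc n) s) s"
    and s: "s \<in> ball a r"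
  shows "(\<lambda>n. mat ((s - a) ^ n / fact n) ** D n a) sums D 0 s"
  unfolding matrix_sums_iff
proof (intro allI)
  fix i j
  have hol: "(\<lambda>s. D 0 s $ i $ j) holomorphic_on ball a r"
    by (rule has_mat_deriv_imp_holomorphic) (rule D)
  have derivs: "\<forall>w\<in>ball a r. (deriv ^^ n) (\<lambda>s. D 0 s $ i $ j) w = D n w $ i $ j" for n
  proof (induction n)
    case (Suc n)
    show ?case
    proof
      fix w assume w: "w \<in> ball a r"
      have "((deriv ^^ n) (\<lambda>s. D 0 s $ i $ j) has_field_derivative D (Suc n) w $ i $ j) (at w)"
        by (rule has_field_derivative_transform_within_open[of "\<lambda>s. D n s $ i $ j" _ _ "ball a r"])
          (use D[OF w, of n] w Suc in \<open>auto simp: has_mat_deriv_def\<close>)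
      then show "(deriv ^^ Suc n) (\<lambda>s. D 0 s $ i $ j) w = D (Suc n) w $ i $ j"
        by (simp add: DERIV_imp_deriv)
    qed
  qed simp
  have "a \<in> ball a r" using s zero_le_dist[of a s] by (simp del: zero_le_dist)
  with derivs have *: "(deriv ^^ n) (\<lambda>s. D 0 s $ i $ j) a = D n a $ i $ j" for n by blast
  have "(\<lambda>n. D n a $ i $ j / fact n * (s - a) ^ n) sums D 0 s $ i $ j"
    using holomorphic_power_series[OF hol s] unfolding * .
  moreover have "(mat ((s - a) ^ n / fact n) ** D n a) $ i $ j = D n a $ i $ j / fact n * (s - a) ^ n" for n
    by (simp add: mult.commute)
  ultimately show "(\<lambda>n. (mat ((s - a) ^ n / fact n) ** D n a) $ i $ j) sums D 0 s $ i $ j"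
    by (simp only:)
qed

subsection \<open>The matrix exponential\<close>

lemma mat_power_mat_mult: "mat_power (mat w ** M) n = mat (w ^ n) ** mat_power M n"
proof (induction n)
  case (Suc n)
  have "mat_power (mat w ** M) (Suc n) = (mat (w ^ n) ** mat_power M n) ** (mat w ** M)"
    by (simp add: Suc)
  then show ?case by (simp add: mat_mult_mult_mat_mult mult.commute)
qed simp

lemma mat_power_Suc_left: "mat_power M (Suc n) = M ** mat_power M n"
proof (induction n)
  case (Suc n)
  have "mat_power M (Suc (Suc n)) = (M ** mat_power M n) ** M"
    by (simp only: mat_power.simps(2)[of M "Suc n"] Suc)
  then show ?case by (simp add: matrix_mul_assoc)
qed simp

lemma norm_mat_power_le:
  fixes M :: "complex^'r^'r"
  assumes "K > 0" "\<And>(A :: complex^'r^'r) (B :: complex^'r^'r). norm (A ** B) \<le> K * norm A * norm B"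
  shows "norm (mat_power M n) \<le> norm (mat 1 :: complex^'r^'r) * (K * norm M) ^ n"
proof (induction n)
  case (Suc n)
  have "norm (mat_power M (Suc n)) \<le> K * norm (mat_power M n) * norm M"
    unfolding mat_power.simps by (rule assms)
  also have "\<dots> \<le> K * (norm (mat 1 :: complex^'r^'r) * (K * norm M) ^ n) * norm M"
    by (intro mult_right_mono mult_left_mono Suc) (use assms in auto)
  finally show ?case by (simp add: mult_ac)
qed simp

lemma summable_mat_exp_entry:
  fixes M :: "complex^'r^'r"
  shows "summable (\<lambda>n. mat_power M n $ i $ j / fact n * w ^ n)"
proof -
  obtain K where K: "K > 0" "\<And>(A :: complex^'r^'r) (B :: complex^'r^'r). norm (A ** B) \<le> K * norm A * norm B"
    using norm_matrix_mult_bound by blast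
  define x where "x = K * norm M * norm w"
  show ?thesis
  proof (rule summable_comparison_test')
    show "summable (\<lambda>n. norm (mat 1 :: complex^'r^'r) * (x ^ n /\<^sub>R fact n))"
      by (intro summable_mult summable_exp_generic)
    fix n
    have "norm (mat_power M n $ i $ j) \<le> norm (mat 1 :: complex^'r^'r) * (K * norm M) ^ n"
      using norm_entry_le norm_mat_power_le[OF K] order_trans by blast
    then have "norm (mat_power M n $ i $ j) / fact n * norm w ^ n
        \<le> norm (mat 1 :: complex^'r^'r) * (K * norm M) ^ n / fact n * norm w ^ n"
      by (intro mult_right_mono divide_right_mono) auto
    moreover have "norm (mat_power M n $ i $ j / fact n * w ^ n)
        = norm (mat_power M n $ i $ j) / fact n * norm w ^ n"
      by (simp add: norm_mult norm_divide norm_power)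
    moreover have "norm (mat 1 :: complex^'r^'r) * (x ^ n /\<^sub>R fact n)
        = norm (mat 1 :: complex^'r^'r) * (K * norm M) ^ n / fact n * norm w ^ n"
      by (simp add: x_def power_mult_distrib divide_inverse)
    ultimately show "norm (mat_power M n $ i $ j / fact n * w ^ n)
        \<le> norm (mat 1 :: complex^'r^'r) * (x ^ n /\<^sub>R fact n)"
      by simp
  qed
qed

lemma mat_exp_sums: "(\<lambda>n. mat (w ^ n / fact n) ** mat_power M n) sums mat_exp (mat w ** M)"
proof -
  have "(\<lambda>n. mat (w ^ n / fact n) ** mat_power M n) sums
      (\<chi> i j. \<Sum>n. mat_power M n $ i $ j / fact n * w ^ n)"
    unfolding matrix_sums_iff
    using summable_sums[OF summable_mat_exp_entry[of M _ _ w]] by (simp add: mult_ac)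
  moreover have "(1 / fact n) *\<^sub>R mat_power (mat w ** M) n = mat (w ^ n / fact n) ** mat_power M n" for n
    by (simp add: scaleR_eq_mat_mult mat_power_mat_mult mat_mult_mat_assoc)
  ultimately show ?thesis
    by (simp add: mat_exp_def sums_iff)
qed

lemma mat_exp_entry: "mat_exp (mat w ** M) $ i $ j = (\<Sum>n. mat_power M n $ i $ j / fact n * w ^ n)"
  using mat_exp_sums[of w M] by (auto simp: matrix_sums_iff sums_iff mult_ac)

lemma has_mat_deriv_exp: "has_mat_deriv (\<lambda>w. mat_exp (mat w ** M)) (M ** mat_exp (mat w ** M)) w"
proof -
  have "(M ** mat_exp (mat w ** M)) $ i $ j =
      (\<Sum>n. diffs (\<lambda>n. mat_power M n $ i $ j / fact n) n * w ^ n)" for i j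
  proof -
    have "(\<lambda>n. M ** (mat (w ^ n / fact n) ** mat_power M n)) sums (M ** mat_exp (mat w ** M))"
      by (intro bounded_linear.sums[OF bounded_bilinear.bounded_linear_right[OF bounded_bilinear_matrix_mult]]
          mat_exp_sums)
    then have "(\<lambda>n. mat (w ^ n / fact n) ** mat_power M (Suc n)) sums (M ** mat_exp (mat w ** M))"
      unfolding mat_power_Suc_left by (simp add: matrix_mult_mat_left[of M])
    then have "(\<lambda>n. (w ^ n / fact n) * mat_power M (Suc n) $ i $ j) sums (M ** mat_exp (mat w ** M)) $ i $ j"
      unfolding matrix_sums_iff by simp
    moreover have "(w ^ n / fact n) * mat_power M (Suc n) $ i $ j
        = diffs (\<lambda>n. mat_power M n $ i $ j / fact n) n * w ^ n" for n
      by (simp add: diffs_def field_simps del: mat_power.simps of_nat_Suc)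
    ultimately show ?thesis by (simp add: sums_iff)
  qed
  then show ?thesis
    unfolding has_mat_deriv_def mat_exp_entry
    using termdiffs_strong_converges_everywhere[OF summable_mat_exp_entry[of M]] by simp
qed

lemma mat_exp_0 [simp]: "mat_exp 0 = mat 1"
proof -
  have "(\<lambda>n. mat (0 ^ n / fact n) ** mat_power (0::complex^'r^'r) n) sums mat 1"
  proof -
    have "(\<lambda>n. 0 ^ n / fact n * mat_power (0::complex^'r^'r) n $ i $ j) sums mat 1 $ i $ j" for i j
      using powser_sums_zero[of "\<lambda>n. mat_power (0::complex^'r^'r) n $ i $ j / fact n"]
      by (simp add: mult_ac)
    then show ?thesis by (simp add: matrix_sums_iff)
  qed
  from sums_unique2[OF mat_exp_sums this] show ?thesis
    by (simp only: mat_0_mult)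
qed

lemma mat_exp_unique:
  assumes Y: "\<And>w. has_mat_deriv Y (N ** Y w) w" and Y0: "Y 0 = mat 1"
  shows "Y w = mat_exp (mat w ** N)"
proof -
  have "(\<lambda>n. mat ((w - 0) ^ n / fact n) ** (mat_power N n ** Y 0)) sums (mat_power N 0 ** Y w)"
  proof (rule has_mat_deriv_taylor[where r = "norm w + 1"])
    show "has_mat_deriv (\<lambda>s. mat_power N n ** Y s) (mat_power N (Suc n) ** Y s) s" for n s
      using has_mat_deriv_cmult[OF Y[of s], of "mat_power N n"] by (simp add: matrix_mul_assoc)
  qed simp
  then have "(\<lambda>n. mat (w ^ n / fact n) ** mat_power N n) sums Y w"
    by (simp add: Y0)
  then show ?thesis
    using sums_unique2 mat_exp_sums by blast
qed

lemma mat_exp_mat_add: "mat_exp (mat w ** (M + mat c)) = mat (exp (c * w)) ** mat_exp (mat w ** M)"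
proof (rule mat_exp_unique[symmetric])
  fix w
  have "((\<lambda>w. exp (c * w)) has_field_derivative c * exp (c * w)) (at w)"
    by (auto intro!: derivative_eq_intros)
  from has_mat_deriv_scalar_mult[OF this has_mat_deriv_exp[of M]]
  show "has_mat_deriv (\<lambda>w. mat (exp (c * w)) ** mat_exp (mat w ** M))
      ((M + mat c) ** (mat (exp (c * w)) ** mat_exp (mat w ** M))) w"
    by (simp add: matrix_add_rdistrib matrix_mult_mat_left[of M] mat_mult_mat_assoc add.commute)
qed (simp add: mat_0_mult)

subsection \<open>Powers and the binomial series\<close>

lemma mat_0 [simp]: "mat 0 = (0 :: complex^'r^'r)"
  by (simp add: vec_eq_iff mat_def)

lemma mat_exp_commute:
  assumes "N ** M = M ** N"
  shows "N ** mat_exp (mat w ** M) = mat_exp (mat w ** M) ** N"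
proof -
  have comm: "N ** mat_power M n = mat_power M n ** N" for n
  proof (induction n)
    case (Suc n)
    have "N ** mat_power M (Suc n) = (N ** mat_power M n) ** M"
      by (simp add: matrix_mul_assoc)
    also have "\<dots> = mat_power M n ** (N ** M)"
      by (simp only: Suc matrix_mul_assoc)
    finally show ?case by (simp add: assms matrix_mul_assoc)
  qed simp
  have "(\<lambda>n. N ** (mat (w ^ n / fact n) ** mat_power M n)) sums (N ** mat_exp (mat w ** M))"
    by (intro bounded_linear.sums[OF bounded_bilinear.bounded_linear_right[OF bounded_bilinear_matrix_mult]]
        mat_exp_sums)
  moreover have "(\<lambda>n. (mat (w ^ n / fact n) ** mat_power M n) ** N) sums (mat_exp (mat w ** M) ** N)"
    by (intro bounded_linear.sums[OF bounded_bilinear.bounded_linear_left[OF bounded_bilinear_matrix_mult]]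
        mat_exp_sums)
  moreover have "N ** (mat (w ^ n / fact n) ** mat_power M n) = (mat (w ^ n / fact n) ** mat_power M n) ** N" for n
    by (simp only: matrix_mult_mat_left[of N] comm matrix_mul_assoc[symmetric])
  ultimately show ?thesis
    by (simp only: sums_unique2)
qed

lemma mat_cpow_add_mat: "mat_cpow t (M + mat c) = mat (exp (c * Ln t)) ** mat_cpow t M"
  by (simp add: mat_cpow_def mat_exp_mat_add)

lemma mat_cpow_1 [simp]: "mat_cpow 1 M = mat 1"
  by (simp add: mat_cpow_def mat_0_mult)

lemma mat_cpow_uminus_commute: "M ** mat_cpow t (- M) = mat_cpow t (- M) ** M"
  unfolding mat_cpow_def
proof (rule mat_exp_commute)
  show "M ** (- M) = (- M) ** M"
    by (simp only: bounded_bilinear.minus_left[OF bounded_bilinear_matrix_mult]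
      bounded_bilinear.minus_right[OF bounded_bilinear_matrix_mult])
qed

lemma mat_cpow_minus_Suc:
  assumes "t \<noteq> 0"
  shows "mat_cpow t (- (M + mat 1)) = mat (1 / t) ** mat_cpow t (- M)"
proof -
  have "- (M + mat 1) = - M + mat (- 1)"
    by (simp add: vec_eq_iff mat_def)
  moreover have "exp (- 1 * Ln t) = 1 / t"
    using assms by (simp add: exp_minus divide_inverse)
  ultimately show ?thesis
    by (simp only: mat_cpow_add_mat)
qed

lemma mat_cpow_minus_of_nat:
  assumes "t \<noteq> 0"
  shows "mat_cpow t (- (M + mat (of_nat n))) = mat (1 / t ^ n) ** mat_cpow t (- M)"
proof -
  have "- (M + mat (of_nat n)) = - M + mat (- of_nat n)"
    by (simp add: vec_eq_iff mat_def)
  moreover have "exp (- of_nat n * Ln t) = 1 / t ^ n"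
    using assms by (simp add: exp_minus exp_of_nat_mult divide_inverse)
  ultimately show ?thesis
    by (simp only: mat_cpow_add_mat)
qed

lemma has_mat_deriv_cpow:
  assumes "t \<notin> \<real>\<^sub>\<le>\<^sub>0"
  shows "has_mat_deriv (\<lambda>t. mat_cpow t M) (mat (1 / t) ** (M ** mat_cpow t M)) t"
  unfolding mat_cpow_def
  by (rule has_mat_deriv_chain[OF has_mat_deriv_exp]) (use assms has_field_derivative_Ln in \<open>simp add: divide_inverse\<close>)

lemma has_mat_deriv_one_minus_cpow:
  assumes "1 - t \<notin> \<real>\<^sub>\<le>\<^sub>0"
  shows "has_mat_deriv (\<lambda>t. mat_cpow (1 - t) (- M)) (M ** mat_cpow (1 - t) (- (M + mat 1))) t"
proof -
  have "1 - t \<noteq> 0" using assms by auto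
  have "((\<lambda>t. 1 - t) has_field_derivative -1) (at t)"
    by (auto intro!: derivative_eq_intros)
  from has_mat_deriv_chain[OF has_mat_deriv_cpow[OF assms, of "- M"] this]
  have "has_mat_deriv (\<lambda>t. mat_cpow (1 - t) (- M))
     (mat (- 1) ** (mat (1 / (1 - t)) ** ((- M) ** mat_cpow (1 - t) (- M)))) t" .
  moreover have "mat (- 1) ** (mat (1 / (1 - t)) ** ((- M) ** mat_cpow (1 - t) (- M)))
      = M ** mat_cpow (1 - t) (- (M + mat 1))"
    unfolding mat_cpow_minus_Suc[OF \<open>1 - t \<noteq> 0\<close>] matrix_mult_mat_left[of M]
      bounded_bilinear.minus_left[OF bounded_bilinear_matrix_mult]
    by (simp add: vec_eq_iff)
  ultimately show ?thesis by simp
qed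

lemma not_nonpos_Reals_if_Re_pos: "Re z > 0 \<Longrightarrow> z \<notin> \<real>\<^sub>\<le>\<^sub>0"
  by (auto simp: complex_nonpos_Reals_iff)

lemma Re_one_minus_pos: "norm z < 1 \<Longrightarrow> Re (1 - z) > 0"
  using complex_Re_le_cmod[of z] by simp

lemma mat_binomial_series:
  assumes "norm x < 1"
  shows "(\<lambda>n. mat (x ^ n / fact n) ** mat_pochhammer P n) sums mat_cpow (1 - x) (- P)"
proof -
  define D where "D = (\<lambda>n t. mat_pochhammer P n ** mat_cpow (1 - t) (- (P + mat (of_nat n))))"
  have "(\<lambda>n. mat ((x - 0) ^ n / fact n) ** D n 0) sums D 0 x"
  proof (rule has_mat_deriv_taylor[where r = 1])
    fix n t assume "t \<in> ball (0::complex) 1"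
    then have "1 - t \<notin> \<real>\<^sub>\<le>\<^sub>0"
      by (intro not_nonpos_Reals_if_Re_pos Re_one_minus_pos) simp
    from has_mat_deriv_cmult[OF has_mat_deriv_one_minus_cpow[OF this, of "P + mat (of_nat n)"],
        of "mat_pochhammer P n"]
    show "has_mat_deriv (D n) (D (Suc n) t) t"
      by (simp add: D_def matrix_mul_assoc mat_add algebra_simps)
  qed (use assms in simp)
  then show ?thesis by (simp add: D_def)
qed

lemma norm_matrix_le_sum: "norm M \<le> (\<Sum>i\<in>UNIV. \<Sum>j\<in>UNIV. norm (M $ i $ j))"
  for M :: "complex^'r^'r"
proof -
  have "norm M \<le> (\<Sum>i\<in>UNIV. norm (M $ i))"
    by (simp add: norm_vec_def L2_set_le_sum)
  also have "\<dots> \<le> (\<Sum>i\<in>UNIV. \<Sum>j\<in>UNIV. norm (M $ i $ j))"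
    by (intro sum_mono) (simp add: norm_vec_def L2_set_le_sum)
  finally show ?thesis .
qed

lemma summable_norm_pochhammer:
  fixes x :: real
  assumes "0 \<le> x" "x < 1"
  shows "summable (\<lambda>n. norm (mat_pochhammer P n) / fact n * x ^ n)"
proof -
  obtain r where r: "x < r" "r < 1" using assms dense by blast
  have "summable (\<lambda>n. norm (mat_pochhammer P n $ i $ j / fact n * of_real x ^ n))" for i j
  proof (rule powser_insidea)
    have "(\<lambda>n. mat (of_real r ^ n / fact n) ** mat_pochhammer P n) sums mat_cpow (1 - of_real r) (- P)"
      by (rule mat_binomial_series) (use r assms in auto)
    then show "summable (\<lambda>n. mat_pochhammer P n $ i $ j / fact n * complex_of_real r ^ n)"
      by (auto simp: matrix_sums_iff sums_iff mult_ac)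
  qed (use r assms in auto)
  then have "summable (\<lambda>n. \<Sum>i\<in>UNIV. \<Sum>j\<in>UNIV. norm (mat_pochhammer P n $ i $ j / fact n * of_real x ^ n))"
    by (intro summable_sum) auto
  moreover have "norm (norm (mat_pochhammer P n) / fact n * x ^ n)
      \<le> (\<Sum>i\<in>UNIV. \<Sum>j\<in>UNIV. norm (mat_pochhammer P n $ i $ j / fact n * of_real x ^ n))" for n
  proof -
    have "norm (mat_pochhammer P n) / fact n * x ^ n
        \<le> (\<Sum>i\<in>UNIV. \<Sum>j\<in>UNIV. norm (mat_pochhammer P n $ i $ j)) / fact n * x ^ n"
      by (intro mult_right_mono divide_right_mono norm_matrix_le_sum) (use assms in auto)
    then show ?thesis
      using assms by (simp add: norm_mult norm_divide norm_power sum_divide_distrib sum_distrib_right)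
  qed
  ultimately show ?thesis
    by (blast intro: summable_comparison_test')
qed

lemma mat_pochhammer_Suc_left: "mat_pochhammer P (Suc n) = P ** mat_pochhammer (P + mat 1) n"
proof (induction n)
  case (Suc n)
  have "mat_pochhammer P (Suc (Suc n)) = mat_pochhammer P (Suc n) ** (P + mat (of_nat (Suc n)))"
    by simp
  also have "\<dots> = P ** (mat_pochhammer (P + mat 1) n ** ((P + mat 1) + mat (of_nat n)))"
    by (simp only: Suc matrix_mul_assoc) (simp add: mat_add add_ac)
  finally show ?case by simp
qed simp

subsection \<open>Exponential decay of the semigroup of a positive stable matrix\<close>

definition poly_apply :: "complex^'r^'r \<Rightarrow> complex poly \<Rightarrow> complex^'r \<Rightarrow> complex^'r" where
  "poly_apply X p v = fold_coeffs (\<lambda>a w. a *s v + X *v w) p 0"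

lemma poly_apply_0 [simp]: "poly_apply X 0 v = 0"
  by (simp add: poly_apply_def)

lemma poly_apply_pCons [simp]: "poly_apply X (pCons a p) v = a *s v + X *v poly_apply X p v"
  by (cases "p = 0 \<and> a = 0") (auto simp: poly_apply_def)

lemma poly_apply_add: "poly_apply X (p + q) v = poly_apply X p v + poly_apply X q v"
  by (induction p q rule: poly_induct2)
    (simp_all add: matrix_vector_right_distrib vec.scale_left_distrib)

lemma poly_apply_smult: "poly_apply X (smult c p) v = c *s poly_apply X p v"
  by (induction p) (simp_all add: vec.scale_right_distrib vec.scale vec.linear_scale)

lemma poly_apply_linear_factor:
  "poly_apply X ([:- c, 1:] * p) v = X *v poly_apply X p v - c *s poly_apply X p v"
proof -
  have "[:- c, 1:] * p = pCons 0 p + smult (- c) p" by simp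
  then show ?thesis
    by (simp only: poly_apply_add poly_apply_smult) (simp add: vec.scale_minus_left)
qed

lemma poly_apply_commute:
  assumes "Y ** X = X ** Y"
  shows "poly_apply X p (Y *v v) = Y *v poly_apply X p v"
proof (induction p)
  case (pCons a p)
  have "X *v (Y *v u) = Y *v (X *v u)" for u
    by (simp add: assms matrix_vector_mul_assoc)
  with pCons show ?case
    by (simp add: matrix_vector_right_distrib vector_scalar_commute)
qed simp

lemma poly_apply_monom: "poly_apply X (monom a n) v = a *s (mat_power X n *v v)"
  by (induction n)
    (simp_all add: monom_0 monom_Suc mat_power_Suc_left vector_scalar_commute
      flip: matrix_vector_mul_assoc del: mat_power.simps(2))

lemma poly_apply_sum: "poly_apply X (\<Sum>i\<in>I. f i) v = (\<Sum>i\<in>I. poly_apply X (f i) v)"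
  by (induction I rule: infinite_finite_induct) (simp_all add: poly_apply_add)

lemma annihilating_poly_exists:
  fixes X :: "complex^'r^'r"
  obtains p where "p \<noteq> 0" "poly_apply X p v = 0"
proof -
  define g where "g = (\<lambda>i. mat_power X i *v v)"
  show ?thesis
  proof (cases "inj_on g {..CARD('r)}")
    case False
    then obtain i j where "i \<noteq> j" "g i = g j" by (auto simp: inj_on_def)
    moreover from \<open>i \<noteq> j\<close> have "monom 1 i + monom (-1) j \<noteq> (0 :: complex poly)"
      by (auto simp: poly_eq_iff intro!: exI[of _ i])
    moreover have "poly_apply X (monom 1 i + monom (-1) j) v = g i - g j"
      by (simp add: poly_apply_add poly_apply_monom g_def vec.scale_minus_left)
    ultimately show ?thesis
      using that by (metis right_minus_eq)
  next
    case True
    then have "card (g ` {..CARD('r)}) = Suc (CARD('r))"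
      by (simp add: card_image)
    then have "vec.dependent (g ` {..CARD('r)})"
      by (intro vec.dependent_biggerset_general)
        (simp add: dim_subset_UNIV_cart_gen le_imp_less_Suc)
    then obtain u w where u: "w \<in> g ` {..CARD('r)}" "u w \<noteq> 0" "(\<Sum>x\<in>g ` {..CARD('r)}. u x *s x) = 0"
      by (auto simp: vec.dependent_finite)
    then obtain k where k: "k \<le> CARD('r)" "w = g k" by auto
    define p where "p = (\<Sum>i\<le>CARD('r). monom (u (g i)) i)"
    have "coeff p k = u (g k)"
      using k by (simp add: p_def coeff_sum if_distrib cong: if_cong)
    then have "p \<noteq> 0" using u k by auto
    moreover have "poly_apply X p v = (\<Sum>i\<le>CARD('r). u (g i) *s g i)"
      by (simp add: p_def poly_apply_sum poly_apply_monom g_def)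
    moreover have "\<dots> = 0"
      using u(3) True by (simp add: sum.reindex)
    ultimately show ?thesis using that by metis
  qed
qed

lemma norm_vec_le_sum: "norm v \<le> (\<Sum>i\<in>UNIV. norm (v $ i))"
  for v :: "complex^'r"
  by (simp add: norm_vec_def L2_set_le_sum)

text \<open>Variation of constants: if \<open>(X - c) v\<close> decays under \<open>exp (- u X)\<close>, then
  \<open>exp (c u) exp (- u X) v\<close> has a derivative that is small compared with \<open>exp (c u)\<close>.\<close>

lemma exp_decay_step:
  fixes X :: "complex^'r^'r"
  assumes c: "Re c > 0" and "\<epsilon> > 0"
    and bd: "\<And>u. u \<ge> 0 \<Longrightarrow>
      norm (mat_exp (mat (- complex_of_real u) ** X) *v (X *v v - c *s v)) \<le> K * exp (- \<epsilon> * u)"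
  shows "\<exists>\<epsilon>'>0. \<exists>K'. \<forall>u\<ge>0. norm (mat_exp (mat (- complex_of_real u) ** X) *v v) \<le> K' * exp (- \<epsilon>' * u)"
proof -
  define e where "e = min \<epsilon> (Re c / 2)"
  have e: "e > 0" "e \<le> \<epsilon>" "e < Re c" using assms by (auto simp: e_def)
  have "K \<ge> 0" using order_trans[OF norm_ge_zero bd[of 0]] by simp
  define E where "E = (\<lambda>s. mat_exp (mat (- s) ** X))"
  define Y where "Y = (\<lambda>i s. exp (c * s) * (E s *v v) $ i)"
  define Z where "Z = (\<lambda>s. E s *v (X *v v - c *s v))"
  have XE: "X *v (E s *v v) = E s *v (X *v v)" for s
    by (simp add: E_def matrix_vector_mul_assoc mat_exp_commute)
  have dE: "has_mat_deriv E (mat (- 1) ** (X ** E s)) s" for s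
    unfolding E_def by (rule has_mat_deriv_chain[OF has_mat_deriv_exp]) (auto intro!: derivative_eq_intros)
  have dY: "(Y i has_field_derivative - exp (c * s) * Z s $ i) (at s)" for i s
  proof -
    have "((\<lambda>s. (E s *v v) $ i) has_field_derivative ((mat (- 1) ** (X ** E s)) *v v) $ i) (at s)"
      unfolding matrix_vector_mult_def
      using dE[of s] by (auto simp: has_mat_deriv_def intro!: derivative_eq_intros)
    moreover have "((mat (- 1) ** (X ** E s)) *v v) $ i = - (E s *v (X *v v)) $ i"
      by (simp add: mat_vector_mult_eq flip: matrix_vector_mul_assoc XE)
    ultimately have "(Y i has_field_derivative
        exp (c * s) * - (E s *v (X *v v)) $ i + c * exp (c * s) * (E s *v v) $ i) (at s)"
      unfolding Y_def by (auto intro!: derivative_eq_intros)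
    moreover have "exp (c * s) * - (E s *v (X *v v)) $ i + c * exp (c * s) * (E s *v v) $ i
        = - exp (c * s) * Z s $ i"
      by (simp add: Z_def matrix_vector_mult_diff_distrib vector_scalar_commute algebra_simps)
    ultimately show ?thesis by simp
  qed
  define K1 where "K1 = K / (Re c - e)"
  have "K1 \<ge> 0" using \<open>K \<ge> 0\<close> e by (simp add: K1_def)
  have Ybd: "norm (Y i (of_real u)) \<le> norm (v $ i) + K1 * exp ((Re c - e) * u)" if "u \<ge> 0" for i u
  proof -
    have "norm (Y i (of_real u) - Y i (of_real 0)) \<le> K1 * exp ((Re c - e) * u) - K1 * exp ((Re c - e) * 0)"
    proof (cases "u = 0")
      case False
      show ?thesis
      proof (rule differentiable_bound_general)
        show "0 < u" using that False by simp
        show vd: "((\<lambda>u. Y i (of_real u)) has_vector_derivative - exp (c * of_real x) * Z (of_real x) $ i) (at x)" for x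
          by (rule has_vector_derivative_real_field[OF dY])
        show "((\<lambda>u. K1 * exp ((Re c - e) * u)) has_vector_derivative K1 * ((Re c - e) * exp ((Re c - e) * x))) (at x)" for x
          unfolding has_real_derivative_iff_has_vector_derivative[symmetric]
          by (auto intro!: derivative_eq_intros)
        show "continuous_on {0..u} (\<lambda>u. K1 * exp ((Re c - e) * u))"
          by (intro continuous_intros)
        show "continuous_on {0..u} (\<lambda>u. Y i (of_real u))"
          by (intro continuous_at_imp_continuous_on ballI has_vector_derivative_continuous[OF vd])
        fix x assume x: "0 < x" "x < u"
        have "norm (Z (of_real x) $ i) \<le> K * exp (- \<epsilon> * x)"
          using order_trans[OF Finite_Cartesian_Product.norm_nth_le bd[of x]] x
          by (simp add: Z_def E_def)
        also have "\<dots> \<le> K * exp (- e * x)"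
          using \<open>K \<ge> 0\<close> e x by (intro mult_left_mono) auto
        finally have "norm (- exp (c * of_real x) * Z (of_real x) $ i) \<le> exp (Re c * x) * (K * exp (- e * x))"
          by (simp add: norm_mult norm_exp_eq_Re)
        also have "\<dots> = K1 * ((Re c - e) * exp ((Re c - e) * x))"
        proof -
          have "exp ((Re c - e) * x) = exp (Re c * x) * exp (- e * x)"
            by (simp add: left_diff_distrib flip: exp_add)
          then show ?thesis using e by (simp add: K1_def)
        qed
        finally show "norm (- exp (c * of_real x) * Z (of_real x) $ i) \<le> K1 * ((Re c - e) * exp ((Re c - e) * x))" .
      qed
    qed simp
    moreover have "Y i (of_real 0) = v $ i" by (simp add: Y_def E_def)
    moreover have "norm (Y i (of_real u)) \<le> norm (Y i (of_real u) - Y i (of_real 0)) + norm (Y i (of_real 0))"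
      using norm_triangle_ineq[of "Y i (of_real u) - Y i (of_real 0)" "Y i (of_real 0)"] by simp
    ultimately show ?thesis using \<open>K1 \<ge> 0\<close> by simp
  qed
  have "norm (E (of_real u) *v v) \<le> (\<Sum>i\<in>UNIV. norm (v $ i) + K1) * exp (- e * u)" if "u \<ge> 0" for u
  proof -
    have "norm ((E (of_real u) *v v) $ i) \<le> (norm (v $ i) + K1) * exp (- e * u)" for i
    proof -
      have "exp (Re c * u) * norm ((E (of_real u) *v v) $ i) = norm (Y i (of_real u))"
        by (simp add: Y_def norm_mult norm_exp_eq_Re)
      also have "\<dots> \<le> norm (v $ i) + K1 * exp ((Re c - e) * u)"
        by (rule Ybd[OF that])
      also have "\<dots> \<le> (norm (v $ i) + K1) * exp ((Re c - e) * u)"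
        using e that by (simp add: distrib_right mult_le_cancel_left1)
      also have "\<dots> = exp (Re c * u) * ((norm (v $ i) + K1) * exp (- e * u))"
      proof -
        have "exp ((Re c - e) * u) = exp (Re c * u) * exp (- e * u)"
          by (simp add: left_diff_distrib flip: exp_add)
        then show ?thesis by simp
      qed
      finally show ?thesis by (simp only: mult_le_cancel_left_pos exp_gt_zero)
    qed
    then have "(\<Sum>i\<in>UNIV. norm ((E (of_real u) *v v) $ i)) \<le> (\<Sum>i\<in>UNIV. (norm (v $ i) + K1) * exp (- e * u))"
      by (intro sum_mono)
    with norm_vec_le_sum[of "E (of_real u) *v v"] show ?thesis
      by (simp add: sum_distrib_right del: sum_constant)
  qed
  then show ?thesis using e unfolding E_def by blast
qed

lemma exp_decay_vector:
  fixes X :: "complex^'r^'r"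
  assumes X: "positive_stable X"
  shows "p \<noteq> 0 \<Longrightarrow> poly_apply X p v = 0 \<Longrightarrow>
    \<exists>\<epsilon>>0. \<exists>K. \<forall>u\<ge>0. norm (mat_exp (mat (- complex_of_real u) ** X) *v v) \<le> K * exp (- \<epsilon> * u)"
proof (induction "degree p" arbitrary: p v)
  case 0
  then obtain a where "p = [:a:]" by (metis degree_eq_zeroE)
  with 0 have "v = 0" by auto
  then show ?case by (intro exI[of _ 1] conjI exI[of _ 0]) auto
next
  case (Suc n)
  have "\<not> constant (poly p)" using Suc.hyps(2) by (simp add: constant_degree)
  then obtain c where "poly p c = 0" using fundamental_theorem_of_algebra by blast
  then obtain q where q: "p = [:- c, 1:] * q" using poly_eq_0_iff_dvd by (metis dvdE)
  with Suc.prems have "q \<noteq> 0" by auto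
  with Suc.hyps(2) q have deg: "n = degree q"
    by (simp add: degree_mult_eq del: mult_pCons_left)
  show ?case
  proof (cases "mat_eigenvalue X c")
    case True
    then have "Re c > 0" using X by (simp add: positive_stable_def)
    have "(X - mat c) ** X = X ** (X - mat c)"
      by (simp only: bounded_bilinear.diff_left[OF bounded_bilinear_matrix_mult]
          bounded_bilinear.diff_right[OF bounded_bilinear_matrix_mult] mult_mat_commute)
    then have "poly_apply X q ((X - mat c) *v v) = (X - mat c) *v poly_apply X q v"
      by (rule poly_apply_commute)
    then have "poly_apply X q (X *v v - c *s v) = 0"
      using Suc.prems(2) unfolding q poly_apply_linear_factor
      by (simp add: matrix_vector_mult_diff_rdistrib mat_vector_mult_eq)
    from Suc.hyps(1)[OF deg \<open>q \<noteq> 0\<close> this] obtain \<epsilon> K where "\<epsilon> > 0"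
      "\<And>u. u \<ge> 0 \<Longrightarrow>
        norm (mat_exp (mat (- complex_of_real u) ** X) *v (X *v v - c *s v)) \<le> K * exp (- \<epsilon> * u)"
      by blast
    then show ?thesis
      by (rule exp_decay_step[OF \<open>Re c > 0\<close>])
  next
    case False
    have "X *v poly_apply X q v = c *s poly_apply X q v"
      using Suc.prems(2) unfolding q poly_apply_linear_factor by simp
    then have "poly_apply X q v = 0"
      using False by (auto simp: mat_eigenvalue_def)
    with Suc.hyps(1)[OF deg \<open>q \<noteq> 0\<close>] show ?thesis by blast
  qed
qed

lemma positive_stable_exp_decay:
  fixes X :: "complex^'r^'r"
  assumes X: "positive_stable X"
  obtains \<epsilon> K where "\<epsilon> > 0" "K \<ge> 0"
    "\<And>u. u \<ge> 0 \<Longrightarrow> norm (mat_exp (mat (- complex_of_real u) ** X)) \<le> K * exp (- \<epsilon> * u)"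
proof -
  have "\<exists>\<epsilon>>0. \<exists>K. \<forall>u\<ge>0. norm (mat_exp (mat (- complex_of_real u) ** X) *v v) \<le> K * exp (- \<epsilon> * u)" for v
    using annihilating_poly_exists[of X v] exp_decay_vector[OF X] by metis
  then obtain e K where e: "\<And>v. e v > 0"
    and K: "\<And>v u. u \<ge> 0 \<Longrightarrow> norm (mat_exp (mat (- complex_of_real u) ** X) *v v) \<le> K v * exp (- e v * u)"
    by metis
  define a where "a = (\<lambda>j::'r. axis j (1::complex))"
  define \<epsilon> where "\<epsilon> = Min (range (\<lambda>j. e (a j)))"
  have \<epsilon>: "\<epsilon> > 0" "\<epsilon> \<le> e (a j)" for j
    using e by (auto simp: \<epsilon>_def)
  have "norm (mat_exp (mat (- complex_of_real u) ** X)) \<le> (\<Sum>i\<in>(UNIV::'r set). \<Sum>j\<in>UNIV. \<bar>K (a j)\<bar>) * exp (- \<epsilon> * u)"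
    if "u \<ge> 0" for u
  proof -
    let ?E = "mat_exp (mat (- complex_of_real u) ** X)"
    have "norm (?E $ i $ j) \<le> \<bar>K (a j)\<bar> * exp (- \<epsilon> * u)" for i j
    proof -
      have "?E $ i $ j = (?E *v a j) $ i"
        by (simp add: a_def matrix_vector_mult_def axis_def if_distrib cong: if_cong)
      then have "norm (?E $ i $ j) \<le> norm (?E *v a j)"
        by (simp add: Finite_Cartesian_Product.norm_nth_le)
      also have "\<dots> \<le> K (a j) * exp (- e (a j) * u)" by (rule K[OF that])
      also have "\<dots> \<le> \<bar>K (a j)\<bar> * exp (- \<epsilon> * u)"
        using \<epsilon> that by (intro mult_mono) (auto simp: mult_right_mono)
      finally show ?thesis .
    qed
    then have "(\<Sum>i\<in>UNIV. \<Sum>j\<in>UNIV. norm (?E $ i $ j)) \<le> (\<Sum>i\<in>(UNIV::'r set). \<Sum>j\<in>UNIV. \<bar>K (a j)\<bar> * exp (- \<epsilon> * u))"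
      by (intro sum_mono)
    with norm_matrix_le_sum[of ?E] show ?thesis by (simp add: sum_distrib_right del: sum_constant)
  qed
  then show ?thesis
    using \<epsilon> by (intro that[of \<epsilon> "\<Sum>i\<in>(UNIV::'r set). \<Sum>j\<in>UNIV. \<bar>K (a j)\<bar>"]) (auto intro!: sum_nonneg)
qed

subsection \<open>The integrand of the extended beta function\<close>

definition beta_integrand ::
    "complex^'r^'r \<Rightarrow> complex^'r^'r \<Rightarrow> complex^'r^'r \<Rightarrow> complex \<Rightarrow> complex^'r^'r" where
  "beta_integrand P Q X s = mat_cpow s (P - mat 1) ** mat_cpow (1 - s) (Q - mat 1)
     ** mat_exp (mat (- (1 / (s * (1 - s)))) ** X)"

lemma strip_not_nonpos_Reals:
  assumes "0 < Re s" "Re s < 1"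
  shows "s \<notin> \<real>\<^sub>\<le>\<^sub>0" "1 - s \<notin> \<real>\<^sub>\<le>\<^sub>0" "s * (1 - s) \<noteq> 0"
  using assms by (auto simp: complex_nonpos_Reals_iff)

lemma has_mat_deriv_beta_integrand:
  assumes "0 < Re s" "Re s < 1"
  shows "\<exists>D. has_mat_deriv (beta_integrand P Q X) D s"
proof -
  note s = strip_not_nonpos_Reals[OF assms]
  have 1: "\<exists>D. ((\<lambda>s. - (1 / (s * (1 - s)))) has_field_derivative D) (at s)"
    unfolding field_differentiable_def[symmetric]
    by (intro derivative_intros) (use s in auto)
  have 2: "((\<lambda>s. 1 - s) has_field_derivative -1) (at s)"
    by (auto intro!: derivative_eq_intros)
  show ?thesis
    unfolding beta_integrand_def
    using has_mat_deriv_mult[OF has_mat_deriv_mult[OF has_mat_deriv_cpow[OF s(1)]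
        has_mat_deriv_chain[OF has_mat_deriv_cpow[OF s(2)] 2]]
        has_mat_deriv_chain[OF has_mat_deriv_exp]] 1 by blast
qed

lemma norm_mat_exp_le:
  fixes M :: "complex^'r^'r"
  obtains a b where "a \<ge> 0" "b \<ge> 0" "\<And>w. norm (mat_exp (mat w ** M)) \<le> a * exp (b * norm w)"
proof -
  obtain K where K: "K > 0" "\<And>(A :: complex^'r^'r) (B :: complex^'r^'r). norm (A ** B) \<le> K * norm A * norm B"
    using norm_matrix_mult_bound by blast
  let ?a = "norm (mat 1 :: complex^'r^'r)" and ?b = "K * norm M"
  have "norm (mat_exp (mat w ** M)) \<le> ?a * exp (?b * norm w)" for w
  proof -
    have s: "(\<lambda>n. ?a * ((?b * norm w) ^ n /\<^sub>R fact n)) sums (?a * exp (?b * norm w))"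
      by (intro sums_mult exp_converges)
    have le: "norm (mat (w ^ n / fact n) ** mat_power M n) \<le> ?a * ((?b * norm w) ^ n /\<^sub>R fact n)" for n
    proof -
      have "norm (mat (w ^ n / fact n) ** mat_power M n) = norm w ^ n / fact n * norm (mat_power M n)"
        by (simp add: norm_mat_mult norm_divide norm_power)
      also have "\<dots> \<le> norm w ^ n / fact n * (?a * ?b ^ n)"
        by (intro mult_left_mono norm_mat_power_le[OF K]) auto
      also have "\<dots> = ?a * ((?b * norm w) ^ n /\<^sub>R fact n)"
        by (simp add: power_mult_distrib divide_inverse)
      finally show ?thesis .
    qed
    have "norm (\<Sum>n. mat (w ^ n / fact n) ** mat_power M n) \<le> (\<Sum>n. ?a * ((?b * norm w) ^ n /\<^sub>R fact n))"
      by (rule norm_suminf_le[OF le]) (use s in \<open>simp add: sums_iff\<close>)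
    then show ?thesis
      using s mat_exp_sums[of w M] by (simp add: sums_iff)
  qed
  then show ?thesis
    using K(1) by (intro that[of ?a ?b]) auto
qed

lemma linear_ln_bound:
  fixes c :: real
  assumes "c \<ge> 0" "\<epsilon> > 0"
  obtains C where "\<And>y. y \<ge> 1 \<Longrightarrow> c * ln y - \<epsilon> * y \<le> C"
proof -
  define k where "k = (c + 1) / \<epsilon>"
  have k: "k > 0" "c / k \<le> \<epsilon>" using assms by (auto simp: k_def field_simps)
  have "c * ln y - \<epsilon> * y \<le> c * ln k" if "y \<ge> 1" for y
  proof -
    have "ln y = ln (y / k) + ln k" using k that by (simp add: ln_div)
    moreover have "ln (y / k) \<le> y / k" using ln_bound[of "y / k"] k that by simp
    ultimately have "c * ln y \<le> c * (y / k + ln k)"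
      using assms by (intro mult_left_mono) auto
    also have "\<dots> = c / k * y + c * ln k" by (simp add: algebra_simps)
    also have "\<dots> \<le> \<epsilon> * y + c * ln k"
      using k that by (intro add_right_mono mult_right_mono) auto
    finally show ?thesis by simp
  qed
  then show ?thesis by (rule that)
qed

lemma bounded_beta_integrand:
  fixes P Q X :: "complex^'r^'r"
  assumes X: "positive_stable X"
  obtains C where "C \<ge> 0" "\<And>s. 0 < s \<Longrightarrow> s < 1 \<Longrightarrow> norm (beta_integrand P Q X (of_real s)) \<le> C"
proof -
  obtain K where K: "K > 0" "\<And>(A :: complex^'r^'r) (B :: complex^'r^'r). norm (A ** B) \<le> K * norm A * norm B"
    using norm_matrix_mult_bound by blast
  obtain a b where ab: "a \<ge> 0" "b \<ge> 0" "\<And>w. norm (mat_exp (mat w ** (P - mat 1))) \<le> a * exp (b * norm w)"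
    using norm_mat_exp_le by blast
  obtain a' b' where ab': "a' \<ge> 0" "b' \<ge> 0" "\<And>w. norm (mat_exp (mat w ** (Q - mat 1))) \<le> a' * exp (b' * norm w)"
    using norm_mat_exp_le by blast
  obtain \<epsilon> L where L: "\<epsilon> > 0" "L \<ge> 0"
    "\<And>u. u \<ge> 0 \<Longrightarrow> norm (mat_exp (mat (- complex_of_real u) ** X)) \<le> L * exp (- \<epsilon> * u)"
    using positive_stable_exp_decay[OF X] by blast
  obtain c where c: "\<And>y. y \<ge> 1 \<Longrightarrow> (b + b') * ln y - \<epsilon> * y \<le> c"
    using linear_ln_bound[of "b + b'" \<epsilon>] ab ab' L by auto
  have "norm (beta_integrand P Q X (of_real s)) \<le> K * (K * a * a') * L * exp c" if s: "0 < s" "s < 1" for s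
  proof -
    define y where "y = 1 / (s * (1 - s))"
    have sy: "s * (1 - s) \<le> s" "s * (1 - s) \<le> 1 - s" "0 < s * (1 - s)"
      using s by (auto simp: mult_left_le mult_left_le_one_le)
    have "s * (1 - s) \<le> 1" using sy s by linarith
    with sy have y1: "y \<ge> 1" by (simp add: y_def)
    have lny: "ln y = - ln (s * (1 - s))" using sy by (simp add: y_def ln_div)
    have nL: "norm (Ln (complex_of_real x)) = - ln x" if "0 < x" "x < 1" for x
      using that by (simp add: Ln_of_real norm_of_real abs_if)
    have "- ln s \<le> ln y" "- ln (1 - s) \<le> ln y"
      unfolding lny using sy s by (simp_all del: mult_pos_pos)
    then have ln: "norm (Ln (complex_of_real s)) \<le> ln y" "norm (Ln (1 - complex_of_real s)) \<le> ln y"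
      using s nL[of s] nL[of "1 - s"] by simp_all
    have n1: "norm (mat_cpow (of_real s) (P - mat 1)) \<le> a * exp (b * ln y)"
      unfolding mat_cpow_def
      by (rule order_trans[OF ab(3)]) (use ab ln(1) in \<open>auto intro!: mult_left_mono\<close>)
    have n2: "norm (mat_cpow (1 - of_real s) (Q - mat 1)) \<le> a' * exp (b' * ln y)"
      unfolding mat_cpow_def
      by (rule order_trans[OF ab'(3)]) (use ab' ln(2) in \<open>auto intro!: mult_left_mono\<close>)
    have n3: "norm (mat_exp (mat (- (1 / (of_real s * (1 - of_real s)))) ** X)) \<le> L * exp (- \<epsilon> * y)"
    proof -
      have "1 / (complex_of_real s * (1 - complex_of_real s)) = of_real y" by (simp add: y_def)
      then show ?thesis using L(3)[of y] y1 by simp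
    qed
    have "norm (beta_integrand P Q X (of_real s))
      \<le> K * (K * (a * exp (b * ln y)) * (a' * exp (b' * ln y))) * (L * exp (- \<epsilon> * y))"
    proof -
      let ?M = "mat_cpow (of_real s) (P - mat 1)" and ?N = "mat_cpow (1 - of_real s) (Q - mat 1)"
      let ?E = "mat_exp (mat (- (1 / (complex_of_real s * (1 - complex_of_real s)))) ** X)"
      have "norm (?M ** ?N) \<le> K * norm ?M * norm ?N" by (rule K(2))
      also have "\<dots> \<le> K * (a * exp (b * ln y)) * (a' * exp (b' * ln y))"
        by (rule mult_mono[OF mult_left_mono[OF n1] n2]) (use K ab in auto)
      finally have MN: "norm (?M ** ?N) \<le> K * (a * exp (b * ln y)) * (a' * exp (b' * ln y))" .
      have "norm (?M ** ?N ** ?E) \<le> K * norm (?M ** ?N) * norm ?E" by (rule K(2))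
      also have "\<dots> \<le> K * (K * (a * exp (b * ln y)) * (a' * exp (b' * ln y))) * (L * exp (- \<epsilon> * y))"
        by (rule mult_mono[OF mult_left_mono[OF MN] n3]) (use K ab ab' in auto)
      finally show ?thesis by (simp only: beta_integrand_def)
    qed
    also have "\<dots> = K * (K * a * a') * L * exp ((b + b') * ln y - \<epsilon> * y)"
      by (simp add: distrib_right exp_add exp_diff exp_minus divide_inverse)
    also have "\<dots> \<le> K * (K * a * a') * L * exp c"
      using K ab ab' L c[OF y1] by (intro mult_left_mono) auto
    finally show ?thesis .
  qed
  then show ?thesis
    using K ab ab' L by (intro that[of "K * (K * a * a') * L * exp c"]) auto
qed

lemma continuous_on_matrix:
  fixes f :: "'a::topological_space \<Rightarrow> complex^'r^'r"
  assumes "\<And>i j. continuous_on S (\<lambda>x. f x $ i $ j)"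
  shows "continuous_on S f"
proof -
  have "continuous_on S (\<lambda>x. \<chi> i j. f x $ i $ j)"
    by (intro continuous_on_vec_lambda assms)
  then show ?thesis by simp
qed

lemma continuous_on_beta_integrand:
  "continuous_on {0<..<1} (\<lambda>s. beta_integrand P Q X (complex_of_real s))"
proof (rule continuous_on_matrix)
  fix i j
  have "(\<lambda>s. beta_integrand P Q X s $ i $ j) holomorphic_on {s. 0 < Re s \<and> Re s < 1}"
  proof -
    have "\<forall>s. \<exists>D. 0 < Re s \<and> Re s < 1 \<longrightarrow> has_mat_deriv (beta_integrand P Q X) D s"
      using has_mat_deriv_beta_integrand by blast
    then obtain D where "\<forall>s. 0 < Re s \<and> Re s < 1 \<longrightarrow> has_mat_deriv (beta_integrand P Q X) (D s) s"
      by (rule choice[elim_format]) blast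
    then show ?thesis by (intro has_mat_deriv_imp_holomorphic[where F = D]) blast
  qed
  then show "continuous_on {0<..<1} (\<lambda>s. beta_integrand P Q X (complex_of_real s) $ i $ j)"
    by (rule continuous_on_compose2[OF holomorphic_on_imp_continuous_on])
      (auto intro!: continuous_on_of_real continuous_on_id)
qed

lemma set_integrable_bounded_continuous:
  fixes f :: "real \<Rightarrow> 'a::euclidean_space"
  assumes "continuous_on {a<..<b} f" "\<And>s. s \<in> {a<..<b} \<Longrightarrow> norm (f s) \<le> C"
  shows "set_integrable lborel {a<..<b} f"
  unfolding set_integrable_def
proof (rule integrableI_bounded_set[where A = "{a<..<b}" and B = C])
  show "(\<lambda>x. indicator {a<..<b} x *\<^sub>R f x) \<in> borel_measurable lborel"
    using borel_measurable_continuous_on_indicator[OF _ assms(1)] by simp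
  show "emeasure lborel {a<..<b} < \<infinity>"
    by (rule emeasure_bounded_finite) simp
qed (use assms(2) in auto)

lemma set_integral_norm_le:
  fixes f :: "real \<Rightarrow> 'a::euclidean_space"
  assumes "continuous_on {a<..<b} f" "\<And>s. s \<in> {a<..<b} \<Longrightarrow> norm (f s) \<le> C" "a \<le> b" "C \<ge> 0"
  shows "norm (LBINT s:{a<..<b}. f s) \<le> C * (b - a)"
proof -
  have int: "integrable lborel (\<lambda>s. indicator {a<..<b} s *\<^sub>R f s)"
    using set_integrable_bounded_continuous[OF assms(1,2)] by (simp add: set_integrable_def)
  have "norm (LBINT s:{a<..<b}. f s) \<le> (\<integral>s. norm (indicator {a<..<b} s *\<^sub>R f s) \<partial>lborel)"
    unfolding set_lebesgue_integral_def by (rule integral_norm_bound)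
  also have "\<dots> \<le> (\<integral>s. C * indicator {a<..<b} s \<partial>lborel)"
  proof (rule integral_mono)
    show "integrable lborel (\<lambda>s. norm (indicator {a<..<b} s *\<^sub>R f s))"
      using int by (rule integrable_norm)
    show "integrable lborel (\<lambda>s. C * indicator {a<..<b} s)"
      by (intro integrable_mult_right integrable_real_indicator) (use assms(3) in auto)
    show "norm (indicator {a<..<b} s *\<^sub>R f s) \<le> C * indicator {a<..<b} s" for s
      using assms(2)[of s] assms(4) by (cases "s \<in> {a<..<b}") simp_all
  qed
  also have "\<dots> = C * (b - a)" using assms(3) by simp
  finally show ?thesis .
qed

lemma set_integral_bounded_linear:
  assumes "bounded_linear T" "set_integrable M A f"
  shows "(LINT x:A|M. T (f x)) = T (LINT x:A|M. f x)"
  using integral_bounded_linear[OF assms(1), of M "\<lambda>x. indicator A x *\<^sub>R f x"] assms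
  by (simp add: set_lebesgue_integral_def set_integrable_def
      linear_scale[OF bounded_linear.linear])

lemma bounded_linear_matrix_entry: "bounded_linear (\<lambda>M :: complex^'r^'r. M $ i $ j)"
  using bounded_linear_compose[OF bounded_linear_vec_nth bounded_linear_vec_nth] .

lemma ext_Beta_shift:
  "ext_Beta (P + mat (of_nat m)) Q X
     = (LBINT s:{0<..<1}. mat (of_real s ^ m) ** beta_integrand P Q X (of_real s))"
proof -
  have "mat_cpow (complex_of_real s) (P + mat (of_nat m) - mat 1)
         ** mat_cpow (complex_of_real (1 - s)) (Q - mat 1)
         ** mat_exp ((- 1 / (s * (1 - s))) *\<^sub>R X)
      = mat (of_real s ^ m) ** beta_integrand P Q X (of_real s)" if "0 < s" for s
  proof -
    have "P + mat (of_nat m) - mat 1 = P - mat 1 + mat (of_nat m)" by simp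
    moreover have "exp (of_nat m * Ln (complex_of_real s)) = of_real s ^ m"
      using that by (simp add: exp_of_nat_mult)
    ultimately have "mat_cpow (complex_of_real s) (P + mat (of_nat m) - mat 1)
        = mat (of_real s ^ m) ** mat_cpow (complex_of_real s) (P - mat 1)"
      by (simp only: mat_cpow_add_mat)
    moreover have "(- 1 / (s * (1 - s))) *\<^sub>R X = mat (- (1 / (of_real s * (1 - of_real s)))) ** X"
      by (simp add: scaleR_eq_mat_mult)
    moreover have "complex_of_real (1 - s) = 1 - of_real s" by simp
    ultimately show ?thesis
      by (simp only: beta_integrand_def matrix_mul_assoc)
  qed
  then show ?thesis
    unfolding ext_Beta_def by (intro set_lebesgue_integral_cong) auto
qed

subsection \<open>The extended Gauss function without its Gamma factors\<close>

definition gauss_series ::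
    "complex^'r^'r \<Rightarrow> complex^'r^'r \<Rightarrow> complex^'r^'r \<Rightarrow> complex^'r^'r \<Rightarrow> complex \<Rightarrow> complex^'r^'r" where
  "gauss_series X Q R P z =
     (\<Sum>m. mat (z ^ m / fact m) ** (mat_pochhammer P m ** ext_Beta (Q + mat (of_nat m)) R X))"

lemma gauss_series_integral_sums:
  fixes P Q R X :: "complex^'r^'r"
  assumes X: "positive_stable X" and z: "norm z < 1"
  shows "(\<lambda>m. mat (z ^ m / fact m) ** (mat_pochhammer P m ** ext_Beta (Q + mat (of_nat m)) R X)) sums
    (LBINT s:{0<..<1}. mat_cpow (1 - z * of_real s) (- P) ** beta_integrand Q R X (of_real s))"
proof -
  let ?W = "\<lambda>s. beta_integrand Q R X (complex_of_real s)"
  obtain K where K: "K > 0" "\<And>(A :: complex^'r^'r) (B :: complex^'r^'r). norm (A ** B) \<le> K * norm A * norm B"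
    using norm_matrix_mult_bound by blast
  obtain C where C: "C \<ge> 0" "\<And>s. 0 < s \<Longrightarrow> s < 1 \<Longrightarrow> norm (?W s) \<le> C"
    using bounded_beta_integrand[OF X] by blast
  define T where "T = (\<lambda>m (M :: complex^'r^'r). mat (z ^ m / fact m) ** (mat_pochhammer P m ** M))"
  have T: "bounded_linear (T m)" for m
    unfolding T_def
    by (intro bounded_linear_compose[OF bounded_bilinear.bounded_linear_right[OF bounded_bilinear_matrix_mult]
          bounded_bilinear.bounded_linear_right[OF bounded_bilinear_matrix_mult]])
  define g where "g = (\<lambda>m s. mat (of_real s ^ m) ** ?W s)"
  have g_cont: "continuous_on {0<..<1} (g m)" for m
  proof (rule continuous_on_matrix)
    show "continuous_on {0<..<1} (\<lambda>s. g m s $ i $ j)" for i j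
      unfolding g_def mat_mult_nth
      by (intro continuous_intros continuous_on_beta_integrand)
  qed
  have g_bd: "norm (g m s) \<le> C" if "s \<in> {0<..<1}" for m s
  proof -
    have "norm (g m s) = s ^ m * norm (?W s)"
      using that by (simp add: g_def norm_mat_mult norm_power)
    also have "\<dots> \<le> 1 * C"
      using that C by (intro mult_mono) (auto simp: power_le_one)
    finally show ?thesis by simp
  qed
  have g_int: "set_integrable lborel {0<..<1} (g m)" for m
    by (rule set_integrable_bounded_continuous[OF g_cont g_bd])
  define f where "f = (\<lambda>m s. indicator {0<..<1} s *\<^sub>R T m (g m s))"
  have f_eq: "f m s = T m (indicator {0<..<1} s *\<^sub>R g m s)" for m s
    by (simp add: f_def linear_scale[OF bounded_linear.linear[OF T]])
  define b where "b = (\<lambda>m. K * C * (norm (mat_pochhammer P m) / fact m * norm z ^ m))"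
  have b: "summable b"
    unfolding b_def by (intro summable_mult summable_norm_pochhammer) (use z in auto)
  have f_bd: "norm (f m s) \<le> b m * indicator {0<..<1} s" for m s
  proof (cases "s \<in> {0<..<1}")
    case True
    have "norm (T m (g m s)) = norm z ^ m / fact m * norm (mat_pochhammer P m ** g m s)"
      by (simp add: T_def norm_mat_mult norm_divide norm_power)
    also have "\<dots> \<le> norm z ^ m / fact m * (K * norm (mat_pochhammer P m) * C)"
      by (intro mult_left_mono order_trans[OF K(2) mult_left_mono[OF g_bd[OF True]]]) (use K in auto)
    finally show ?thesis using True by (simp add: f_def b_def mult_ac)
  qed (simp add: f_def)
  have f_int: "integrable lborel (f m)" for m
  proof -
    have "f m = (\<lambda>s. T m (indicator {0<..<1} s *\<^sub>R g m s))" by (simp add: f_eq fun_eq_iff)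
    then show ?thesis
      using integrable_bounded_linear[OF T g_int[unfolded set_integrable_def]] by simp
  qed
  have b0: "b m \<ge> 0" for m using K C by (simp add: b_def)
  have "(\<lambda>m. integral\<^sup>L lborel (f m)) sums (\<integral>s. (\<Sum>m. f m s) \<partial>lborel)"
  proof (rule sums_integral)
    show "AE s in lborel. summable (\<lambda>m. norm (f m s))"
    proof (rule AE_I2)
      fix s
      show "summable (\<lambda>m. norm (f m s))"
      proof (rule summable_comparison_test'[OF b])
        show "norm (norm (f m s)) \<le> b m" for m
          using f_bd[of m s] b0[of m] by (cases "s \<in> {0<..<1}") simp_all
      qed
    qed
    show "summable (\<lambda>m. \<integral>s. norm (f m s) \<partial>lborel)"
    proof (rule summable_comparison_test'[OF b])
      fix m
      have "(\<integral>s. norm (f m s) \<partial>lborel) \<le> (\<integral>s. b m * indicator {0<..<1::real} s \<partial>lborel)"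
      proof (rule integral_mono)
        show "integrable lborel (\<lambda>s. norm (f m s))"
          using f_int by (rule integrable_norm)
        show "integrable lborel (\<lambda>s. b m * indicator {0<..<1::real} s)"
          by (intro integrable_mult_right integrable_real_indicator) auto
      qed (rule f_bd)
      then show "norm (\<integral>s. norm (f m s) \<partial>lborel) \<le> b m" by simp
    qed
  qed (rule f_int)
  moreover have "integral\<^sup>L lborel (f m)
      = mat (z ^ m / fact m) ** (mat_pochhammer P m ** ext_Beta (Q + mat (of_nat m)) R X)" for m
    using set_integral_bounded_linear[OF T g_int, of m]
    by (simp add: f_def set_lebesgue_integral_def ext_Beta_shift g_def T_def)
  moreover have "(\<Sum>m. f m s) = indicator {0<..<1} s *\<^sub>R (mat_cpow (1 - z * of_real s) (- P) ** ?W s)" for s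
  proof (cases "s \<in> {0<..<1}")
    case True
    then have "norm (z * of_real s) < 1"
      using z mult_left_le[of s "norm z"] by (simp add: norm_mult)
    from bounded_linear.sums[OF bounded_bilinear.bounded_linear_left[OF bounded_bilinear_matrix_mult]
        mat_binomial_series[OF this, of P]]
    have "(\<lambda>n. (mat ((z * of_real s) ^ n / fact n) ** mat_pochhammer P n) ** ?W s) sums
       (mat_cpow (1 - z * of_real s) (- P) ** ?W s)" .
    moreover have "(mat ((z * of_real s) ^ n / fact n) ** mat_pochhammer P n) ** ?W s = f n s" for n
    proof -
      have "T n (g n s) = mat (z ^ n / fact n) ** (mat (of_real s ^ n) ** (mat_pochhammer P n ** ?W s))"
        unfolding T_def g_def by (simp only: matrix_mult_mat_left[of "mat_pochhammer P n"])
      then show ?thesis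
        using True by (simp add: f_def mat_mult_mat_assoc power_mult_distrib flip: matrix_mul_assoc)
    qed
    ultimately show ?thesis using True by (simp add: sums_iff)
  qed (simp add: f_def)
  ultimately show ?thesis
    unfolding set_lebesgue_integral_def by (simp only:)
qed

lemma gauss_series_sums:
  fixes P Q R X :: "complex^'r^'r"
  assumes "positive_stable X" "norm z < 1"
  shows "(\<lambda>m. mat (z ^ m / fact m) ** (mat_pochhammer P m ** ext_Beta (Q + mat (of_nat m)) R X))
    sums gauss_series X Q R P z"
  using gauss_series_integral_sums[OF assms, THEN sums_summable]
  by (simp add: gauss_series_def summable_sums)

lemma gauss_series_integral:
  fixes P Q R X :: "complex^'r^'r"
  assumes "positive_stable X" "norm z < 1"
  shows "gauss_series X Q R P z =
    (LBINT s:{0<..<1}. mat_cpow (1 - z * of_real s) (- P) ** beta_integrand Q R X (of_real s))"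
  using gauss_series_integral_sums[OF assms] gauss_series_sums[OF assms] sums_unique2 by blast

lemma matrix_power_series_deriv:
  fixes C :: "nat \<Rightarrow> complex^'r^'r"
  assumes F: "\<And>w. norm w < r \<Longrightarrow> (\<lambda>m. mat (w ^ m) ** C m) sums F w" and w: "norm w < r"
  obtains D where "has_mat_deriv F D w" "(\<lambda>m. mat (of_nat m * w ^ m) ** C m) sums (mat w ** D)"
proof -
  define D where "D = (\<chi> i j. \<Sum>n. diffs (\<lambda>m. C m $ i $ j) n * w ^ n)"
  have F_entry: "(\<lambda>m. C m $ i $ j * s ^ m) sums F s $ i $ j" if "norm s < r" for s i j
    using F[OF that] by (simp add: matrix_sums_iff mult.commute)
  then have summ: "norm s < r \<Longrightarrow> summable (\<lambda>m. C m $ i $ j * s ^ m)" for s i j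
    using sums_summable by blast
  have "has_mat_deriv F D w"
    unfolding has_mat_deriv_def
  proof (intro allI)
    fix i j
    have "((\<lambda>s. \<Sum>m. C m $ i $ j * s ^ m) has_field_derivative D $ i $ j) (at w)"
      unfolding D_def using termdiffs_strong'[OF summ w] by simp
    then show "((\<lambda>s. F s $ i $ j) has_field_derivative D $ i $ j) (at w)"
      by (rule has_field_derivative_transform_within_open[of _ _ _ "ball 0 r"])
        (use w F_entry in \<open>auto simp: sums_iff\<close>)
  qed
  moreover have "(\<lambda>m. mat (of_nat m * w ^ m) ** C m) sums (mat w ** D)"
    unfolding matrix_sums_iff mat_mult_nth
  proof (intro allI)
    fix i j
    have "summable (\<lambda>n. diffs (\<lambda>m. C m $ i $ j) n * w ^ n)"
      by (rule termdiff_converges[OF w summ])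
    from sums_mult[OF diffs_equiv[OF this], of w]
    have "(\<lambda>m. w * (of_nat m * C m $ i $ j * w ^ (m - Suc 0))) sums (w * D $ i $ j)"
      by (simp add: D_def)
    moreover have "w * (of_nat m * C m $ i $ j * w ^ (m - Suc 0)) = of_nat m * w ^ m * C m $ i $ j" for m
      by (cases m) (simp_all add: mult_ac)
    ultimately show "(\<lambda>m. of_nat m * w ^ m * C m $ i $ j) sums (w * D $ i $ j)"
      by (simp only:)
  qed
  ultimately show ?thesis by (rule that)
qed

lemma mat_pochhammer_commute: "P ** mat_pochhammer P n = mat_pochhammer P n ** P"
proof (induction n)
  case (Suc n)
  have "P ** mat_pochhammer P (Suc n) = (P ** mat_pochhammer P n) ** (P + mat (of_nat n))"
    by (simp add: matrix_mul_assoc)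
  also have "\<dots> = mat_pochhammer P n ** (P ** (P + mat (of_nat n)))"
    by (simp only: Suc matrix_mul_assoc)
  also have "P ** (P + mat (of_nat n)) = (P + mat (of_nat n)) ** P"
    by (simp only: matrix_add_ldistrib matrix_add_rdistrib mult_mat_commute)
  finally show ?case by (simp add: matrix_mul_assoc)
qed simp

text \<open>The contiguous relation \<open>P F(P) + w F'(P) = P F(P + I)\<close> comes from
  \<open>(P)\<^sub>m (P + m I) = P (P + I)\<^sub>m\<close>.\<close>

lemma gauss_series_contiguous:
  fixes P Q R X :: "complex^'r^'r"
  assumes X: "positive_stable X" and w: "norm w < 1"
  obtains D where "has_mat_deriv (gauss_series X Q R P) D w"
    "P ** gauss_series X Q R P w + mat w ** D = P ** gauss_series X Q R (P + mat 1) w"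
proof -
  let ?b = "\<lambda>m. ext_Beta (Q + mat (of_nat m)) R X"
  define C where "C = (\<lambda>m. mat (1 / fact m) ** (mat_pochhammer P m ** ?b m))"
  have "(\<lambda>m. mat (s ^ m) ** C m) sums gauss_series X Q R P s" if "norm s < 1" for s
    using gauss_series_sums[OF X that, of P Q R] by (simp add: C_def mat_mult_mat_assoc)
  from matrix_power_series_deriv[OF this w]
  obtain D where D: "has_mat_deriv (gauss_series X Q R P) D w"
    "(\<lambda>m. mat (of_nat m * w ^ m) ** C m) sums (mat w ** D)" by blast
  note sums_left = bounded_linear.sums[OF bounded_bilinear.bounded_linear_right[OF bounded_bilinear_matrix_mult]]
  have "(\<lambda>m. P ** (mat (w ^ m / fact m) ** (mat_pochhammer P m ** ?b m)) + mat (of_nat m * w ^ m) ** C m)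
      sums (P ** gauss_series X Q R P w + mat w ** D)"
    by (intro sums_add D(2) sums_left gauss_series_sums X w)
  moreover have "P ** (mat (w ^ m / fact m) ** (mat_pochhammer P m ** ?b m)) + mat (of_nat m * w ^ m) ** C m
      = P ** (mat (w ^ m / fact m) ** (mat_pochhammer (P + mat 1) m ** ?b m))" for m
  proof -
    have "P ** mat_pochhammer P m + mat (of_nat m) ** mat_pochhammer P m = mat_pochhammer P (Suc m)"
      by (simp add: matrix_add_ldistrib mat_pochhammer_commute mult_mat_commute)
    then have "P ** mat_pochhammer P m + mat (of_nat m) ** mat_pochhammer P m = P ** mat_pochhammer (P + mat 1) m"
      by (simp only: mat_pochhammer_Suc_left)
    then have "(P ** mat_pochhammer P m + mat (of_nat m) ** mat_pochhammer P m) ** ?b m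
        = P ** (mat_pochhammer (P + mat 1) m ** ?b m)"
      by (simp only: matrix_mul_assoc)
    then have "mat (w ^ m / fact m) ** (P ** (mat_pochhammer P m ** ?b m) + mat (of_nat m) ** (mat_pochhammer P m ** ?b m))
        = mat (w ^ m / fact m) ** (P ** (mat_pochhammer (P + mat 1) m ** ?b m))"
      by (simp only: matrix_add_rdistrib matrix_mul_assoc)
    then show ?thesis
      by (simp add: C_def matrix_mult_mat_left[of P] matrix_add_ldistrib mat_mult_mat_assoc mult.commute)
  qed
  moreover have "(\<lambda>m. P ** (mat (w ^ m / fact m) ** (mat_pochhammer (P + mat 1) m ** ?b m)))
      sums (P ** gauss_series X Q R (P + mat 1) w)"
    by (intro sums_left gauss_series_sums X w)
  ultimately have "P ** gauss_series X Q R P w + mat w ** D = P ** gauss_series X Q R (P + mat 1) w"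
    by (simp only: sums_unique2)
  with D(1) show ?thesis by (rule that)
qed

lemma has_mat_deriv_cpow_gauss_series:
  fixes P Q R X :: "complex^'r^'r"
  assumes X: "positive_stable X" and t: "norm t < 1" "norm z < norm (1 - t)"
  defines "V \<equiv> \<lambda>P t. mat_cpow (1 - t) (- P) ** gauss_series X Q R P (z / (1 - t))"
  shows "has_mat_deriv (V P) (P ** V (P + mat 1) t) t"
proof -
  have cut: "1 - t \<notin> \<real>\<^sub>\<le>\<^sub>0"
    by (intro not_nonpos_Reals_if_Re_pos Re_one_minus_pos t)
  then have nz: "1 - t \<noteq> 0" by auto
  define w where "w = z / (1 - t)"
  have w: "norm w < 1" using t nz by (simp add: w_def norm_divide)
  obtain D where D: "has_mat_deriv (gauss_series X Q R P) D w"
    "P ** gauss_series X Q R P w + mat w ** D = P ** gauss_series X Q R (P + mat 1) w"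
    using gauss_series_contiguous[OF X w] by blast
  have "((\<lambda>t. z / (1 - t)) has_field_derivative (1 / (1 - t)) * w) (at t)"
    using nz by (auto intro!: derivative_eq_intros simp: w_def power2_eq_square)
  from has_mat_deriv_mult[OF has_mat_deriv_one_minus_cpow[OF cut, of P]
      has_mat_deriv_chain[OF D(1)[unfolded w_def] this]]
  have "has_mat_deriv (V P) (P ** mat_cpow (1 - t) (- (P + mat 1)) ** gauss_series X Q R P w
      + mat_cpow (1 - t) (- P) ** (mat (1 / (1 - t) * w) ** D)) t"
    by (simp add: V_def w_def)
  moreover have "P ** mat_cpow (1 - t) (- (P + mat 1)) ** gauss_series X Q R P w
      + mat_cpow (1 - t) (- P) ** (mat (1 / (1 - t) * w) ** D) = P ** V (P + mat 1) t"
  proof -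
    let ?c = "mat_cpow (1 - t) (- P)" and ?d = "mat (1 / (1 - t))"
    have A: "P ** mat_cpow (1 - t) (- (P + mat 1)) ** G = ?d ** (?c ** (P ** G))" for G
    proof -
      have "P ** (?d ** ?c) = ?d ** (P ** ?c)"
        by (rule matrix_mult_mat_left)
      then have "P ** mat_cpow (1 - t) (- (P + mat 1)) ** G = ?d ** (P ** ?c) ** G"
        by (simp only: mat_cpow_minus_Suc[OF nz])
      then show ?thesis
        by (simp only: mat_cpow_uminus_commute matrix_mul_assoc)
    qed
    have B: "?c ** (mat (1 / (1 - t) * w) ** D) = ?d ** (?c ** (mat w ** D))"
      by (simp only: mat_mult_mat_assoc[symmetric] matrix_mult_mat_left[of ?c])
    have "P ** mat_cpow (1 - t) (- (P + mat 1)) ** gauss_series X Q R P w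
        + ?c ** (mat (1 / (1 - t) * w) ** D)
        = ?d ** (?c ** (P ** gauss_series X Q R P w + mat w ** D))"
      by (simp only: A B matrix_add_ldistrib)
    also have "\<dots> = ?d ** (?c ** (P ** gauss_series X Q R (P + mat 1) w))"
      by (simp only: D(2))
    also have "\<dots> = P ** V (P + mat 1) t"
      unfolding A[symmetric] by (simp only: V_def w_def matrix_mul_assoc)
    finally show ?thesis .
  qed
  ultimately show ?thesis by simp
qed

lemma cpow_gauss_series_taylor:
  fixes A Q R X :: "complex^'r^'r"
  assumes X: "positive_stable X" and t: "norm z + norm t < 1"
  shows "(\<lambda>n. mat (t ^ n / fact n) ** (mat_pochhammer A n ** gauss_series X Q R (A + mat (of_nat n)) z))
    sums (mat_cpow (1 - t) (- A) ** gauss_series X Q R A (z / (1 - t)))"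
proof -
  define V where "V = (\<lambda>P t. mat_cpow (1 - t) (- P) ** gauss_series X Q R P (z / (1 - t)))"
  define D where "D = (\<lambda>n t. mat_pochhammer A n ** V (A + mat (of_nat n)) t)"
  have "(\<lambda>n. mat ((t - 0) ^ n / fact n) ** D n 0) sums D 0 t"
  proof (rule has_mat_deriv_taylor[where r = "1 - norm z"])
    fix n s assume "s \<in> ball (0::complex) (1 - norm z)"
    then have s: "norm s < 1 - norm z" by simp
    have "norm s < 1" "norm z < norm (1 - s)"
      using s norm_ge_zero[of z] norm_triangle_ineq2[of 1 s] by (auto simp del: norm_ge_zero)
    from has_mat_deriv_cmult[OF has_mat_deriv_cpow_gauss_series[OF X this, where P = "A + mat (of_nat n)" and Q = Q and R = R],
        of "mat_pochhammer A n"]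
    show "has_mat_deriv (D n) (D (Suc n) s) s"
      by (simp add: D_def V_def matrix_mul_assoc mat_add algebra_simps)
  qed (use t in simp)
  then show ?thesis by (simp add: D_def V_def)
qed

subsection \<open>Deforming the path of integration\<close>

lemma norm_one_minus_mult_shift:
  fixes z :: complex and x y :: real
  defines "e \<equiv> if Im z \<ge> 0 then \<i> else - \<i>"
  assumes "y \<ge> 0"
  shows "norm (1 - z * (of_real x + of_real y * e)) ^ 2 \<ge> norm (1 - z * of_real x) ^ 2 + (norm z * y) ^ 2"
proof -
  have "norm (1 - z * (of_real x + of_real y * e)) ^ 2
      = norm (1 - z * of_real x) ^ 2 + (norm z * y) ^ 2 + 2 * \<bar>Im z\<bar> * y"
    unfolding power_mult_distrib cmod_power2 e_def
    by (simp add: power2_eq_square algebra_simps)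
  then show ?thesis using assms by simp
qed

lemma primitive_increment_le:
  fixes G g :: "complex \<Rightarrow> complex"
  assumes "\<And>s. s \<in> closed_segment a b \<Longrightarrow> (G has_field_derivative g s) (at s)"
    and "\<And>s. s \<in> closed_segment a b \<Longrightarrow> norm (g s) \<le> C"
  shows "norm (G b - G a) \<le> C * norm (b - a)"
  by (rule field_differentiable_bound[of "closed_segment a b" G g])
    (use assms in \<open>auto intro: has_field_derivative_at_within\<close>)

text \<open>The second condition cuts off the half-plane beyond the horizontal line through \<open>1 / z\<close>, which
  contains all \<open>s\<close> with \<open>1 - z s\<close> on the branch cut.\<close>

definition slit_strip :: "complex \<Rightarrow> complex set" where
  "slit_strip z = {s. 0 < Re s \<and> Re s < 1 \<and>
     (Im z = 0 \<or> - (Im z)\<^sup>2 < (norm z)\<^sup>2 * Im z * Im s)}"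

lemma slit_strip_halfspaces:
  "slit_strip z = {s. 0 < Re s} \<inter> {s. Re s < 1} \<inter>
     (if Im z = 0 then UNIV else {s. Im s * ((norm z)\<^sup>2 * Im z) > - (Im z)\<^sup>2})"
  by (auto simp: slit_strip_def mult_ac)

lemma open_slit_strip: "open (slit_strip z)"
  unfolding slit_strip_halfspaces
  by (intro open_Int) (auto intro!: open_Collect_less continuous_intros)

lemma convex_slit_strip: "convex (slit_strip z)"
proof -
  have "linear (\<lambda>s. Im s * c)" for c :: real
    by (auto simp: linear_iff algebra_simps)
  then have "convex {s. Im s * c > k}" for c k :: real
    using convex_linear_vimage[of "\<lambda>s. Im s * c" "{k<..}"] by (simp add: vimage_def)
  then show ?thesis
    unfolding slit_strip_halfspaces
    by (intro convex_Int) (auto simp: convex_halfspace_Re_gt convex_halfspace_Re_lt)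
qed

lemma slit_strip_not_nonpos_Reals:
  assumes z: "norm z < 1" and s: "s \<in> slit_strip z"
  shows "1 - z * s \<notin> \<real>\<^sub>\<le>\<^sub>0"
proof
  assume "1 - z * s \<in> \<real>\<^sub>\<le>\<^sub>0"
  then have re: "Re z * Re s - Im z * Im s \<ge> 1" and im: "Re z * Im s + Im z * Re s = 0"
    by (auto simp: complex_nonpos_Reals_iff)
  show False
  proof (cases "Im z = 0")
    case True
    have "\<bar>Re z\<bar> < 1" using z abs_Re_le_cmod order_le_less_trans by blast
    moreover have "Re z * Re s \<le> \<bar>Re z\<bar> * 1"
      using s by (intro mult_mono) (auto simp: slit_strip_def)
    ultimately show False using re True by simp
  next
    case False
    have "(norm z)\<^sup>2 * Im z * Im s = Im z * (Re z * (Re z * Im s) + Im z * Im z * Im s)"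
      unfolding cmod_power2 by (simp add: power2_eq_square algebra_simps)
    also have "Re z * Im s = - Im z * Re s" using im by simp
    also have "Im z * (Re z * (- Im z * Re s) + Im z * Im z * Im s)
        = - (Im z)\<^sup>2 * (Re z * Re s - Im z * Im s)"
      by (simp add: power2_eq_square algebra_simps)
    also have "\<dots> \<le> - (Im z)\<^sup>2 * 1"
      using re by (intro mult_left_mono_neg) auto
    finally show False using s False by (simp add: slit_strip_def)
  qed
qed

lemma of_real_in_slit_strip: "0 < x \<Longrightarrow> x < 1 \<Longrightarrow> of_real x \<in> slit_strip z"
  by (simp add: slit_strip_def)

lemma set_integral_eq_primitive:
  fixes G g :: "complex \<Rightarrow> complex"
  assumes "a \<le> b" "\<And>x. x \<in> {a..b} \<Longrightarrow> (G has_field_derivative g (of_real x)) (at (of_real x))"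
    and int: "set_integrable lborel {a..b} (\<lambda>x. g (of_real x))"
  shows "(LBINT x:{a..b}. g (of_real x)) = G (of_real b) - G (of_real a)"
proof -
  have "((\<lambda>x. g (of_real x)) has_integral (G (of_real b) - G (of_real a))) {a..b}"
    by (rule fundamental_theorem_of_calculus[OF assms(1)])
      (rule has_vector_derivative_real_field, rule assms(2))
  then show ?thesis
    using set_borel_integral_eq_integral(2)[OF int] by (simp add: integral_unique)
qed

text \<open>The integrand is holomorphic in the strip, and moving the middle part of \<open>(0,1)\<close> away
  from \<open>1/z\<close> makes the minimum of \<open>\<bar>1 - z s\<bar>\<close> over the path arbitrarily close to its minimum over
  the two end points. On the segment itself that minimum can be smaller.\<close>

lemma deformed_integral_bound:
  fixes h :: "complex \<Rightarrow> complex"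
  assumes z: "norm z < 1"
    and h: "h holomorphic_on slit_strip z"
    and bd: "\<And>s. 0 < s \<Longrightarrow> s < 1 \<Longrightarrow> norm (h (of_real s)) \<le> C"
    and x: "0 < x" "x < 1" "x < norm (1 - z)"
  shows "\<exists>M. \<forall>n. norm (LBINT s:{0<..<1}. h (of_real s) / (1 - z * of_real s) ^ n) * x ^ n \<le> M"
proof -
  define e where "e = (if Im z \<ge> 0 then \<i> else - \<i>)"
  define \<delta> where "\<delta> = (min 1 (norm (1 - z)) - x) / 3"
  have \<delta>: "\<delta> > 0" "\<delta> < 1 / 2" "x + \<delta> \<le> 1" "x + \<delta> \<le> norm (1 - z)" "x \<le> 1 - \<delta>" "x \<le> norm (1 - z) - \<delta>"
  proof -
    define m where "m = min 1 (norm (1 - z))"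
    have "3 * \<delta> = m - x" by (simp add: \<delta>_def m_def)
    moreover have "x < m" "m \<le> 1" "m \<le> norm (1 - z)" using x by (auto simp: m_def)
    ultimately show "\<delta> > 0" "\<delta> < 1 / 2" "x + \<delta> \<le> 1" "x + \<delta> \<le> norm (1 - z)" "x \<le> 1 - \<delta>" "x \<le> norm (1 - z) - \<delta>"
      using x by auto
  qed
  define K where "K = 1 / norm z"
  have "K \<ge> 0" by (simp add: K_def)
  have "norm (h (of_real (1 / 2))) \<le> C" by (rule bd) auto
  then have C: "C \<ge> 0" by (rule order_trans[OF norm_ge_zero])
  have near: "x \<le> norm (1 - z * of_real s)" if "s \<in> {0..\<delta>} \<union> {1 - \<delta>..1}" for s
    using that
  proof
    assume s: "s \<in> {0..\<delta>}"
    have "norm (z * of_real s) \<le> 1 * \<delta>"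
      unfolding norm_mult using s z by (intro mult_mono) auto
    then show ?thesis using norm_triangle_ineq2[of 1 "z * of_real s"] \<delta> by simp
  next
    assume s: "s \<in> {1 - \<delta>..1}"
    have "norm (z * of_real (1 - s)) \<le> 1 * \<delta>"
      unfolding norm_mult norm_of_real using s z by (intro mult_mono) auto
    moreover have "1 - z * of_real s = (1 - z) - (- (z * of_real (1 - s)))"
      by (simp add: algebra_simps)
    ultimately show ?thesis
      using norm_triangle_ineq2[of "1 - z" "- (z * of_real (1 - s))"] \<delta>
      by (simp only: norm_minus_cancel)
  qed
  have nz: "1 - z * s \<noteq> 0" if "s \<in> slit_strip z" for s
    using slit_strip_not_nonpos_Reals[OF z that] by auto
  define p where "p = (\<lambda>u v. complex_of_real u + of_real v * e)"
  have p_strip: "p u v \<in> slit_strip z" if "0 < u" "u < 1" "v \<ge> 0" for u v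
  proof -
    have "Im z = 0 \<or> - (Im z)\<^sup>2 < (norm z)\<^sup>2 * Im z * Im (p u v)"
    proof (cases "Im z = 0")
      case False
      have "Im z * Im (p u v) = \<bar>Im z\<bar> * v" by (simp add: p_def e_def)
      then have "0 \<le> (norm z)\<^sup>2 * (Im z * Im (p u v))" using that by simp
      moreover have "- (Im z)\<^sup>2 < 0" using False by simp
      ultimately have "- (Im z)\<^sup>2 < (norm z)\<^sup>2 * (Im z * Im (p u v))" by linarith
      then show ?thesis unfolding mult.assoc by (rule disjI2)
    qed simp
    moreover have "Re (p u v) = u" by (simp add: p_def e_def)
    ultimately show ?thesis using that by (simp add: slit_strip_def)
  qed
  have p_norm: "norm (1 - z * p u v) ^ 2 \<ge> norm (1 - z * of_real u) ^ 2 + (norm z * v) ^ 2" if "v \<ge> 0" for u v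
    unfolding p_def e_def using norm_one_minus_mult_shift[OF that] .
  have p_vert: "x \<le> norm (1 - z * p u v)" if "u \<in> {\<delta>, 1 - \<delta>}" "v \<ge> 0" for u v
  proof -
    have "norm (1 - z * of_real u) ^ 2 \<le> norm (1 - z * p u v) ^ 2"
      using p_norm[OF that(2), of u] zero_le_power2[of "norm z * v"] by linarith
    then have "norm (1 - z * of_real u) \<le> norm (1 - z * p u v)"
      by (rule power2_le_imp_le) simp
    moreover have "x \<le> norm (1 - z * of_real u)" using that \<delta> by (intro near) auto
    ultimately show ?thesis by linarith
  qed
  have p_hor: "x \<le> norm (1 - z * p u K)" for u
  proof (cases "z = 0")
    case False
    have "1 ^ 2 \<le> norm (1 - z * p u K) ^ 2"
    proof -
      have "norm z * K = 1" using False by (simp add: K_def)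
      then have "norm (1 - z * of_real u) ^ 2 + 1 \<le> norm (1 - z * p u K) ^ 2"
        using p_norm[OF \<open>K \<ge> 0\<close>, of u] by simp
      then show ?thesis
        using zero_le_power2[of "norm (1 - z * of_real u)"] unfolding power_one by linarith
    qed
    then have "1 \<le> norm (1 - z * p u K)" by (rule power2_le_imp_le) simp
    then show ?thesis using x by linarith
  qed (use x in simp)
  define \<Gamma>1 where "\<Gamma>1 = closed_segment (p \<delta> 0) (p \<delta> K)"
  define \<Gamma>2 where "\<Gamma>2 = closed_segment (p \<delta> K) (p (1 - \<delta>) K)"
  define \<Gamma>3 where "\<Gamma>3 = closed_segment (p (1 - \<delta>) K) (p (1 - \<delta>) 0)"
  have \<Gamma>13: "\<exists>u v. s = p u v \<and> u \<in> {\<delta>, 1 - \<delta>} \<and> v \<ge> 0" if "s \<in> \<Gamma>1 \<union> \<Gamma>3" for s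
    using that
  proof
    assume "s \<in> \<Gamma>1"
    then obtain r where r: "0 \<le> r" "s = (1 - r) *\<^sub>R p \<delta> 0 + r *\<^sub>R p \<delta> K"
      by (auto simp: \<Gamma>1_def closed_segment_def)
    then have "s = p \<delta> (r * K)" by (simp add: p_def scaleR_conv_of_real algebra_simps)
    moreover have "r * K \<ge> 0" using r \<open>K \<ge> 0\<close> by simp
    ultimately show ?thesis by blast
  next
    assume "s \<in> \<Gamma>3"
    then obtain r where r: "r \<le> 1" "s = (1 - r) *\<^sub>R p (1 - \<delta>) K + r *\<^sub>R p (1 - \<delta>) 0"
      by (auto simp: \<Gamma>3_def closed_segment_def)
    then have "s = p (1 - \<delta>) ((1 - r) * K)" by (simp add: p_def scaleR_conv_of_real algebra_simps)
    moreover have "(1 - r) * K \<ge> 0" using r \<open>K \<ge> 0\<close> by simp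
    ultimately show ?thesis by blast
  qed
  have \<Gamma>2: "\<exists>u. s = p u K" if "s \<in> \<Gamma>2" for s
  proof -
    obtain r where "s = (1 - r) *\<^sub>R p \<delta> K + r *\<^sub>R p (1 - \<delta>) K"
      using \<open>s \<in> \<Gamma>2\<close> by (auto simp: \<Gamma>2_def closed_segment_def)
    then have "s = p ((1 - r) * \<delta> + r * (1 - \<delta>)) K" by (simp add: p_def scaleR_conv_of_real algebra_simps)
    then show ?thesis ..
  qed
  have far: "x \<le> norm (1 - z * s)" if "s \<in> \<Gamma>1 \<union> \<Gamma>2 \<union> \<Gamma>3" for s
  proof (cases "s \<in> \<Gamma>2")
    case True
    then show ?thesis using \<Gamma>2 p_hor by blast
  next
    case False
    then have "s \<in> \<Gamma>1 \<union> \<Gamma>3" using that by blast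
    then show ?thesis using \<Gamma>13 p_vert by blast
  qed
  have sub: "\<Gamma>1 \<union> \<Gamma>2 \<union> \<Gamma>3 \<subseteq> slit_strip z"
    unfolding \<Gamma>1_def \<Gamma>2_def \<Gamma>3_def
    using \<delta> \<open>K \<ge> 0\<close> by (intro Un_least closed_segment_subset convex_slit_strip p_strip) auto
  have "compact (h ` (\<Gamma>1 \<union> \<Gamma>2 \<union> \<Gamma>3))"
    by (intro compact_continuous_image continuous_on_subset[OF holomorphic_on_imp_continuous_on[OF h] sub])
      (auto simp: \<Gamma>1_def \<Gamma>2_def \<Gamma>3_def intro!: compact_Un compact_segment)
  then have "bounded (h ` (\<Gamma>1 \<union> \<Gamma>2 \<union> \<Gamma>3))" by (rule compact_imp_bounded)
  then obtain C1 where "\<forall>w \<in> h ` (\<Gamma>1 \<union> \<Gamma>2 \<union> \<Gamma>3). norm w \<le> C1"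
    unfolding bounded_iff by blast
  then have C1: "norm (h s) \<le> C1" if "s \<in> \<Gamma>1 \<union> \<Gamma>2 \<union> \<Gamma>3" for s
    using that by blast
  define L where "L = norm (p \<delta> K - p \<delta> 0) + norm (p (1 - \<delta>) K - p \<delta> K) + norm (p (1 - \<delta>) 0 - p (1 - \<delta>) K)"
  have "norm (LBINT s:{0<..<1}. h (of_real s) / (1 - z * of_real s) ^ n) * x ^ n \<le> C + C1 * L + C" for n
  proof -
    define g where "g = (\<lambda>s. h s / (1 - z * s) ^ n)"
    have g_le: "norm (g s) \<le> B / x ^ n" if "norm (h s) \<le> B" "x \<le> norm (1 - z * s)" for s B
      unfolding g_def norm_divide norm_power
      using that x by (intro frac_le power_mono) (auto intro: order_trans[OF norm_ge_zero])
    have g_hol: "g holomorphic_on slit_strip z"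
      unfolding g_def using nz by (intro holomorphic_intros h) auto
    then obtain G where "\<And>s. s \<in> slit_strip z \<Longrightarrow> (G has_field_derivative g s) (at s within slit_strip z)"
      using holomorphic_convex_primitive'[OF convex_slit_strip open_slit_strip] by blast
    then have G: "(G has_field_derivative g s) (at s)" if "s \<in> slit_strip z" for s
      using \<open>\<And>s. s \<in> slit_strip z \<Longrightarrow> (G has_field_derivative g s) (at s within slit_strip z)\<close>[OF that]
      by (simp only: at_within_open[OF that open_slit_strip])
    have g_cont: "continuous_on {0<..<1} (\<lambda>s. g (complex_of_real s))"
      by (rule continuous_on_compose2[OF holomorphic_on_imp_continuous_on[OF g_hol]])
        (auto intro!: continuous_on_of_real continuous_on_id of_real_in_slit_strip)
    have g_int: "set_integrable lborel {0<..<1} (\<lambda>s. g (complex_of_real s))"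
    proof (rule set_integrable_bounded_continuous[OF g_cont])
      fix s :: real assume s: "s \<in> {0<..<1}"
      have "norm (z * of_real s) \<le> norm z * 1"
        unfolding norm_mult using s by (intro mult_left_mono) auto
      then have "1 - norm z \<le> norm (1 - z * of_real s)"
        using norm_triangle_ineq2[of 1 "z * of_real s"] by simp
      then show "norm (g (of_real s)) \<le> C / (1 - norm z) ^ n"
        unfolding g_def norm_divide norm_power
        using s bd C z by (intro frac_le power_mono) auto
    qed
    have sub_int: "set_integrable lborel A (\<lambda>s. g (complex_of_real s))" if "A \<subseteq> {0<..<1}" "A \<in> sets lborel" for A
      using set_integrable_subset[OF g_int that(2,1)] .
    have split: "{0<..<1} = {0<..<\<delta>} \<union> {\<delta>..1 - \<delta>} \<union> {1 - \<delta><..<1}"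
      using \<delta> by auto
    have "(LBINT s:{0<..<1}. g (of_real s)) = (LBINT s:{0<..<\<delta>} \<union> {\<delta>..1 - \<delta>}. g (of_real s))
        + (LBINT s:{1 - \<delta><..<1}. g (of_real s))"
      unfolding split using \<delta> by (intro set_integral_Un sub_int) auto
    also have "(LBINT s:{0<..<\<delta>} \<union> {\<delta>..1 - \<delta>}. g (of_real s))
        = (LBINT s:{0<..<\<delta>}. g (of_real s)) + (LBINT s:{\<delta>..1 - \<delta>}. g (of_real s))"
      using \<delta> by (intro set_integral_Un sub_int) auto
    also have "(LBINT s:{\<delta>..1 - \<delta>}. g (of_real s)) = G (of_real (1 - \<delta>)) - G (of_real \<delta>)"
      using \<delta> by (intro set_integral_eq_primitive G sub_int of_real_in_slit_strip) auto
    finally have int: "(LBINT s:{0<..<1}. g (of_real s))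
        = (LBINT s:{0<..<\<delta>}. g (of_real s)) + (G (p (1 - \<delta>) 0) - G (p \<delta> 0))
          + (LBINT s:{1 - \<delta><..<1}. g (of_real s))"
      by (simp add: p_def)
    have "norm (LBINT s:{0<..<\<delta>}. g (of_real s)) \<le> C / x ^ n * (\<delta> - 0)"
    proof (rule set_integral_norm_le)
      fix s :: real assume "s \<in> {0<..<\<delta>}"
      then show "norm (g (of_real s)) \<le> C / x ^ n"
        using \<delta> by (intro g_le bd near) auto
    qed (use \<delta> C x in \<open>auto intro: continuous_on_subset[OF g_cont]\<close>)
    also have "\<dots> \<le> C / x ^ n * 1"
      using \<delta> C x by (intro mult_left_mono) auto
    finally have left: "norm (LBINT s:{0<..<\<delta>}. g (of_real s)) \<le> C / x ^ n" by simp
    have "norm (LBINT s:{1 - \<delta><..<1}. g (of_real s)) \<le> C / x ^ n * (1 - (1 - \<delta>))"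
    proof (rule set_integral_norm_le)
      fix s :: real assume "s \<in> {1 - \<delta><..<1}"
      then show "norm (g (of_real s)) \<le> C / x ^ n"
        using \<delta> by (intro g_le bd near) auto
    qed (use \<delta> C x in \<open>auto intro: continuous_on_subset[OF g_cont]\<close>)
    also have "\<dots> \<le> C / x ^ n * 1"
      using \<delta> C x by (intro mult_left_mono) auto
    finally have right: "norm (LBINT s:{1 - \<delta><..<1}. g (of_real s)) \<le> C / x ^ n" by simp
    have G': "(G has_field_derivative g s) (at s)" "norm (g s) \<le> C1 / x ^ n" if "s \<in> \<Gamma>1 \<union> \<Gamma>2 \<union> \<Gamma>3" for s
      using G sub g_le[OF C1 far] that by blast+
    have 1: "norm (G (p \<delta> K) - G (p \<delta> 0)) \<le> C1 / x ^ n * norm (p \<delta> K - p \<delta> 0)"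
      by (rule primitive_increment_le[OF G']) (auto simp: \<Gamma>1_def)
    have 2: "norm (G (p (1 - \<delta>) K) - G (p \<delta> K)) \<le> C1 / x ^ n * norm (p (1 - \<delta>) K - p \<delta> K)"
      by (rule primitive_increment_le[OF G']) (auto simp: \<Gamma>2_def)
    have 3: "norm (G (p (1 - \<delta>) 0) - G (p (1 - \<delta>) K)) \<le> C1 / x ^ n * norm (p (1 - \<delta>) 0 - p (1 - \<delta>) K)"
      by (rule primitive_increment_le[OF G']) (auto simp: \<Gamma>3_def)
    have sum: "G (p (1 - \<delta>) 0) - G (p \<delta> 0) = (G (p \<delta> K) - G (p \<delta> 0))
        + (G (p (1 - \<delta>) K) - G (p \<delta> K)) + (G (p (1 - \<delta>) 0) - G (p (1 - \<delta>) K))" by simp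
    have mid: "norm (G (p (1 - \<delta>) 0) - G (p \<delta> 0)) \<le> C1 / x ^ n * L"
      unfolding L_def distrib_left sum by (intro norm_triangle_mono 1 2 3)
    have "norm (LBINT s:{0<..<1}. g (of_real s)) \<le> C / x ^ n + C1 / x ^ n * L + C / x ^ n"
      unfolding int by (intro norm_triangle_mono left mid right)
    also have "\<dots> = (C + C1 * L + C) / x ^ n" by (simp add: add_divide_distrib)
    finally have "norm (LBINT s:{0<..<1}. g (of_real s)) * x ^ n \<le> C + C1 * L + C"
      using x by (simp add: pos_le_divide_eq)
    then show ?thesis by (simp only: g_def)
  qed
  then show ?thesis by blast
qed

lemma norm_gauss_series_shift_bound:
  fixes A Q R X :: "complex^'r^'r"
  assumes X: "positive_stable X" and z: "norm z < 1" and x: "0 < x" "x < 1" "x < norm (1 - z)"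
  obtains M where "\<And>n. norm (gauss_series X Q R (A + mat (of_nat n)) z) * x ^ n \<le> M"
proof -
  define H where "H = (\<lambda>s. mat_cpow (1 - z * s) (- A) ** beta_integrand Q R X s)"
  have nz: "1 - z * s \<notin> \<real>\<^sub>\<le>\<^sub>0" if "s \<in> slit_strip z" for s
    using slit_strip_not_nonpos_Reals[OF z that] .
  have cpow_deriv: "has_mat_deriv (\<lambda>s. mat_cpow (1 - z * s) (- A))
      (mat (- z) ** (mat (1 / (1 - z * s)) ** (- A ** mat_cpow (1 - z * s) (- A)))) s"
    if "1 - z * s \<notin> \<real>\<^sub>\<le>\<^sub>0" for s
    by (rule has_mat_deriv_chain[where f = "\<lambda>t. mat_cpow t (- A)" and g = "\<lambda>s. 1 - z * s",
          OF has_mat_deriv_cpow[OF that]]) (auto intro!: derivative_eq_intros)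
  have "\<forall>s. \<exists>D. s \<in> slit_strip z \<longrightarrow> has_mat_deriv H D s"
  proof (intro allI)
    fix s
    show "\<exists>D. s \<in> slit_strip z \<longrightarrow> has_mat_deriv H D s"
    proof (cases "s \<in> slit_strip z")
      case True
      then have "0 < Re s" "Re s < 1" by (auto simp: slit_strip_def)
      then obtain D where "has_mat_deriv (beta_integrand Q R X) D s"
        using has_mat_deriv_beta_integrand by blast
      from has_mat_deriv_mult[OF cpow_deriv[OF nz[OF True]] this] show ?thesis
        unfolding H_def by blast
    qed blast
  qed
  then obtain D where "\<forall>s. s \<in> slit_strip z \<longrightarrow> has_mat_deriv H (D s) s"
    by (rule choice[elim_format]) blast
  then have H_hol: "(\<lambda>s. H s $ i $ j) holomorphic_on slit_strip z" for i j
    by (intro has_mat_deriv_imp_holomorphic[where F = D]) blast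
  obtain K where K: "K > 0" "\<And>(A :: complex^'r^'r) (B :: complex^'r^'r). norm (A ** B) \<le> K * norm A * norm B"
    using norm_matrix_mult_bound by blast
  obtain C where C: "C \<ge> 0" "\<And>s. 0 < s \<Longrightarrow> s < 1 \<Longrightarrow> norm (beta_integrand Q R X (of_real s)) \<le> C"
    using bounded_beta_integrand[OF X] by blast
  have Re_pos: "1 - z * of_real s \<notin> \<real>\<^sub>\<le>\<^sub>0" if "s \<in> {0..1}" for s
    using that z mult_left_le[of s "norm z"]
    by (intro not_nonpos_Reals_if_Re_pos Re_one_minus_pos) (simp add: norm_mult)
  have "continuous_on {0..1} (\<lambda>s. mat_cpow (1 - z * complex_of_real s) (- A))"
  proof (rule continuous_on_matrix)
    fix i j
    have "(\<lambda>s. mat_cpow (1 - z * s) (- A) $ i $ j) holomorphic_on {s. 1 - z * s \<notin> \<real>\<^sub>\<le>\<^sub>0}"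
      by (rule has_mat_deriv_imp_holomorphic) (rule cpow_deriv, simp)
    then show "continuous_on {0..1} (\<lambda>s. mat_cpow (1 - z * complex_of_real s) (- A) $ i $ j)"
      by (rule continuous_on_compose2[OF holomorphic_on_imp_continuous_on])
        (auto intro!: continuous_on_of_real continuous_on_id Re_pos simp del: of_real_eq_1_iff)
  qed
  then have "bounded ((\<lambda>s. mat_cpow (1 - z * complex_of_real s) (- A)) ` {0..1})"
    by (intro compact_imp_bounded compact_continuous_image) auto
  then obtain C' where C': "\<And>s. s \<in> {0..1} \<Longrightarrow> norm (mat_cpow (1 - z * complex_of_real s) (- A)) \<le> C'"
    unfolding bounded_iff by blast
  have H_bd: "norm (H (of_real s) $ i $ j) \<le> K * C' * C" if s: "0 < s" "s < 1" for s i j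
  proof -
    have "norm (H (of_real s) $ i $ j) \<le> norm (H (of_real s))" by (rule norm_entry_le)
    also have "\<dots> \<le> K * norm (mat_cpow (1 - z * complex_of_real s) (- A)) * norm (beta_integrand Q R X (of_real s))"
      unfolding H_def by (rule K(2))
    also have "\<dots> \<le> K * C' * C"
      using s K C C'[of s] order_trans[OF norm_ge_zero C'[of s]] by (intro mult_mono) auto
    finally show ?thesis .
  qed
  have "\<forall>i j. \<exists>M. \<forall>n. norm (LBINT s:{0<..<1}. H (of_real s) $ i $ j / (1 - z * of_real s) ^ n) * x ^ n \<le> M"
    by (intro allI deformed_integral_bound[OF z H_hol H_bd x])
  then obtain M where "\<forall>i j n. norm (LBINT s:{0<..<1}. H (of_real s) $ i $ j / (1 - z * of_real s) ^ n) * x ^ n \<le> M i j"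
    by (subst (asm) choice_iff, subst (asm) choice_iff) blast
  then have M: "norm (LBINT s:{0<..<1}. H (of_real s) $ i $ j / (1 - z * of_real s) ^ n) * x ^ n \<le> M i j" for i j n
    by blast
  have entry: "gauss_series X Q R (A + mat (of_nat n)) z $ i $ j
      = (LBINT s:{0<..<1}. H (of_real s) $ i $ j / (1 - z * of_real s) ^ n)" for n i j
  proof -
    let ?f = "\<lambda>s. mat_cpow (1 - z * complex_of_real s) (- (A + mat (of_nat n))) ** beta_integrand Q R X (of_real s)"
    have eq: "?f s = mat (1 / (1 - z * of_real s) ^ n) ** H (of_real s)" if "s \<in> {0<..<1}" for s
    proof -
      have nz': "1 - z * complex_of_real s \<noteq> 0" using Re_pos[of s] that by auto
      show ?thesis
        unfolding H_def by (simp only: mat_cpow_minus_of_nat[OF nz'] matrix_mul_assoc)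
    qed
    have "set_integrable lborel {0<..<1} ?f"
    proof (rule set_integrable_bounded_continuous)
      have "continuous_on {0<..<1} (\<lambda>s. mat (1 / (1 - z * of_real s) ^ n) ** H (complex_of_real s))"
      proof (rule continuous_on_matrix)
        fix i j
        have "(\<lambda>s. 1 / (1 - z * s) ^ n * H s $ i $ j) holomorphic_on slit_strip z"
          using nz by (intro holomorphic_intros H_hol) force+
        then show "continuous_on {0<..<1} (\<lambda>s. (mat (1 / (1 - z * of_real s) ^ n) ** H (complex_of_real s)) $ i $ j)"
          unfolding mat_mult_nth
          by (rule continuous_on_compose2[OF holomorphic_on_imp_continuous_on])
            (auto intro!: continuous_on_of_real continuous_on_id of_real_in_slit_strip)
      qed
      then show "continuous_on {0<..<1} ?f"
        by (rule continuous_on_eq) (simp only: eq)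
      fix s :: real assume s: "s \<in> {0<..<1}"
      have "norm (z * of_real s) \<le> norm z * 1"
        unfolding norm_mult using s by (intro mult_left_mono) auto
      then have ge: "1 - norm z \<le> norm (1 - z * of_real s)"
        using norm_triangle_ineq2[of 1 "z * of_real s"] by simp
      have "norm (?f s) = norm (H (of_real s)) / norm (1 - z * of_real s) ^ n"
        unfolding eq[OF s] by (simp add: norm_mat_mult norm_divide norm_power)
      also have "\<dots> \<le> (\<Sum>i\<in>(UNIV::'r set). \<Sum>j\<in>(UNIV::'r set). K * C' * C) / (1 - norm z) ^ n"
      proof (rule frac_le)
        show H_le: "norm (H (of_real s)) \<le> (\<Sum>i\<in>(UNIV::'r set). \<Sum>j\<in>(UNIV::'r set). K * C' * C)"
          using s by (intro order_trans[OF norm_matrix_le_sum] sum_mono H_bd) auto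
        show "0 \<le> (\<Sum>i\<in>(UNIV::'r set). \<Sum>j\<in>(UNIV::'r set). K * C' * C)"
          by (rule order_trans[OF norm_ge_zero H_le])
        show "(1 - norm z) ^ n \<le> norm (1 - z * of_real s) ^ n"
          using z ge by (intro power_mono) auto
      qed (use z in simp)
      finally show "norm (?f s) \<le> (\<Sum>i\<in>(UNIV::'r set). \<Sum>j\<in>(UNIV::'r set). K * C' * C) / (1 - norm z) ^ n" .
    qed
    from set_integral_bounded_linear[OF bounded_linear_matrix_entry this, of i j]
    have "gauss_series X Q R (A + mat (of_nat n)) z $ i $ j = (LBINT s:{0<..<1}. ?f s $ i $ j)"
      by (simp only: gauss_series_integral[OF X z])
    also have "\<dots> = (LBINT s:{0<..<1}. H (of_real s) $ i $ j / (1 - z * of_real s) ^ n)"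
      by (intro set_lebesgue_integral_cong) (simp_all add: eq del: minus_add_distrib)
    finally show ?thesis .
  qed
  have "norm (gauss_series X Q R (A + mat (of_nat n)) z) * x ^ n \<le> (\<Sum>i\<in>UNIV. \<Sum>j\<in>UNIV. M i j)" for n
  proof -
    have "norm (gauss_series X Q R (A + mat (of_nat n)) z) * x ^ n
        \<le> (\<Sum>i\<in>UNIV. \<Sum>j\<in>UNIV. norm (gauss_series X Q R (A + mat (of_nat n)) z $ i $ j)) * x ^ n"
      using x by (intro mult_right_mono norm_matrix_le_sum) auto
    also have "\<dots> = (\<Sum>i\<in>UNIV. \<Sum>j\<in>UNIV. norm (gauss_series X Q R (A + mat (of_nat n)) z $ i $ j) * x ^ n)"
      by (simp add: sum_distrib_right)
    also have "\<dots> \<le> (\<Sum>i\<in>UNIV. \<Sum>j\<in>UNIV. M i j)"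
      unfolding entry by (intro sum_mono M)
    finally show ?thesis .
  qed
  then show ?thesis by (rule that)
qed

subsection \<open>Analytic continuation in the expansion variable\<close>

lemma summable_shifted_gauss_series:
  fixes A Q R X :: "complex^'r^'r"
  assumes X: "positive_stable X" and z: "norm z < 1" and t: "norm t < 1" "norm t < norm (1 - z)"
  shows "summable (\<lambda>n. (mat_pochhammer A n ** gauss_series X Q R (A + mat (of_nat n)) z) $ i $ j / fact n * t ^ n)"
proof -
  obtain x where "norm t < x" "x < min 1 (norm (1 - z))"
    using dense[of "norm t" "min 1 (norm (1 - z))"] t by auto
  then have x: "norm t < x" "0 < x" "x < 1" "x < norm (1 - z)"
    using norm_ge_zero[of t] by (auto simp del: norm_ge_zero)
  obtain M where M: "\<And>n. norm (gauss_series X Q R (A + mat (of_nat n)) z) * x ^ n \<le> M"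
    using norm_gauss_series_shift_bound[OF X z x(2-4)] by blast
  obtain K where K: "K > 0" "\<And>(A :: complex^'r^'r) (B :: complex^'r^'r). norm (A ** B) \<le> K * norm A * norm B"
    using norm_matrix_mult_bound by blast
  show ?thesis
  proof (rule summable_comparison_test')
    show "summable (\<lambda>n. K * M * (norm (mat_pochhammer A n) / fact n * (norm t / x) ^ n))"
      using x by (intro summable_mult summable_norm_pochhammer) auto
    fix n
    let ?G = "gauss_series X Q R (A + mat (of_nat n)) z"
    have G: "norm ?G \<le> M / x ^ n"
      using M[of n] x by (simp add: pos_le_divide_eq)
    have "norm ((mat_pochhammer A n ** ?G) $ i $ j) \<le> K * norm (mat_pochhammer A n) * norm ?G"
      using norm_entry_le K(2) by (rule order_trans)
    also have "\<dots> \<le> K * norm (mat_pochhammer A n) * (M / x ^ n)"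
      using K by (intro mult_left_mono G) auto
    finally have "norm ((mat_pochhammer A n ** ?G) $ i $ j) / fact n * norm t ^ n
        \<le> K * norm (mat_pochhammer A n) * (M / x ^ n) / fact n * norm t ^ n"
      by (intro mult_right_mono divide_right_mono) auto
    then show "norm ((mat_pochhammer A n ** ?G) $ i $ j / fact n * t ^ n)
        \<le> K * M * (norm (mat_pochhammer A n) / fact n * (norm t / x) ^ n)"
      by (simp add: norm_mult norm_divide norm_power power_divide mult_ac)
  qed
qed

lemma connected_lune:
  fixes r \<rho> :: real
  assumes "r < 1" "\<rho> \<le> 1"
  shows "connected {s :: complex. norm s < \<rho> \<and> r < norm (1 - s)}" (is "connected ?U")
proof -
  have "connected_component ?U 0 s" if s: "s \<in> ?U" for s
  proof -
    define q where "q = (if Re s > 0 then \<i> * of_real (Im s) else s)"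
    have q: "Re q \<le> 0" "norm q \<le> norm s"
      using abs_Im_le_cmod[of s] by (auto simp: q_def norm_mult)
    have left: "p \<in> ?U" if "p \<in> closed_segment 0 q" for p
    proof -
      obtain u where u: "0 \<le> u" "u \<le> 1" "p = u *\<^sub>R q"
        using \<open>p \<in> closed_segment 0 q\<close> by (auto simp: closed_segment_def)
      then have "norm p \<le> norm s"
        using q mult_left_le_one_le[of "norm q" u] by simp
      moreover have "Re p \<le> 0" using u q by (simp add: mult_nonneg_nonpos)
      then have "1 \<le> norm (1 - p)" using complex_Re_le_cmod[of "1 - p"] by simp
      ultimately show ?thesis using s assms by simp
    qed
    have right: "p \<in> ?U" if "p \<in> closed_segment q s" for p
    proof (cases "Re s > 0")
      case True
      obtain u where u: "0 \<le> u" "u \<le> 1" "p = (1 - u) *\<^sub>R q + u *\<^sub>R s"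
        using \<open>p \<in> closed_segment q s\<close> by (auto simp: closed_segment_def)
      have p: "Re p = u * Re s" "Im p = Im s"
        unfolding u(3) q_def using True by (simp_all add: algebra_simps)
      have "Re s < 1" using s assms complex_Re_le_cmod[of s] by simp
      have Re_p: "0 \<le> Re p" "Re p \<le> Re s"
        using u(1,2) True by (simp_all add: p mult_left_le_one_le)
      then have "(Re p)\<^sup>2 \<le> (Re s)\<^sup>2" by (rule power_mono[rotated])
      then have "norm p \<le> norm s" by (simp add: cmod_def p)
      moreover have "(1 - Re s)\<^sup>2 \<le> (1 - Re p)\<^sup>2"
        using Re_p \<open>Re s < 1\<close> by (intro power_mono) auto
      then have "norm (1 - s) \<le> norm (1 - p)" by (simp add: cmod_def p)
      ultimately show ?thesis using s by simp
    next
      case False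
      then show ?thesis using s that by (simp add: q_def)
    qed
    have "connected (closed_segment 0 q \<union> closed_segment q s)"
      by (intro connected_Un) auto
    then show ?thesis
      unfolding connected_component_def using left right
      by (intro exI[of _ "closed_segment 0 q \<union> closed_segment q s"]) auto
  qed
  then show ?thesis
    unfolding connected_iff_connected_component
    by (blast intro: connected_component_sym connected_component_trans)
qed

lemma cpow_gauss_series_sums:
  fixes A Q R X :: "complex^'r^'r"
  assumes X: "positive_stable X" and z: "norm z < 1" and t: "norm t < 1" "norm t < norm (1 - z)"
    and zt: "norm z < norm (1 - t)"
  shows "(\<lambda>n. mat (t ^ n / fact n) ** (mat_pochhammer A n ** gauss_series X Q R (A + mat (of_nat n)) z))
    sums (mat_cpow (1 - t) (- A) ** gauss_series X Q R A (z / (1 - t)))"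
  unfolding matrix_sums_iff
proof (intro allI)
  fix i j
  define \<rho> where "\<rho> = min 1 (norm (1 - z))"
  define c where "c = (\<lambda>n. (mat_pochhammer A n ** gauss_series X Q R (A + mat (of_nat n)) z) $ i $ j / fact n)"
  define g where "g = (\<lambda>s. \<Sum>n. c n * s ^ n)"
  define f where "f = (\<lambda>s. (mat_cpow (1 - s) (- A) ** gauss_series X Q R A (z / (1 - s))) $ i $ j)"
  define U where "U = {s :: complex. norm s < \<rho> \<and> norm z < norm (1 - s)}"
  have g_sums: "(\<lambda>n. c n * s ^ n) sums g s" if "norm s < \<rho>" for s
    using summable_shifted_gauss_series[OF X z, of s A Q R i j] that
    by (simp add: g_def c_def \<rho>_def summable_sums)
  have "g t = f t"
  proof (rule analytic_continuation_open[where s = "ball 0 (1 - norm z)" and s' = U and f = g and g = f])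
    show "open (ball (0::complex) (1 - norm z))" by simp
    show "open U"
      unfolding U_def by (intro open_Collect_conj open_Collect_less continuous_intros)
    show "ball (0::complex) (1 - norm z) \<noteq> {}" using z by simp
    show "connected U"
      unfolding U_def by (rule connected_lune) (use z in \<open>auto simp: \<rho>_def\<close>)
    show "ball 0 (1 - norm z) \<subseteq> U"
    proof
      fix s :: complex assume "s \<in> ball 0 (1 - norm z)"
      then have s: "norm s < 1 - norm z" by simp
      have "1 - norm z \<le> norm (1 - z)" "1 - norm s \<le> norm (1 - s)"
        using norm_triangle_ineq2[of 1 z] norm_triangle_ineq2[of 1 s] by simp_all
      then show "s \<in> U" using s norm_ge_zero[of z] unfolding U_def \<rho>_def mem_Collect_eq by linarith
    qed
    have "g holomorphic_on ball 0 \<rho>"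
      by (rule power_series_holomorphic[where a = c]) (use g_sums in simp)
    then show "g holomorphic_on U"
      by (rule holomorphic_on_subset) (auto simp: U_def)
    show "f holomorphic_on U"
      unfolding f_def
    proof (rule has_mat_deriv_imp_holomorphic)
      fix s assume "s \<in> U"
      then show "has_mat_deriv (\<lambda>s. mat_cpow (1 - s) (- A) ** gauss_series X Q R A (z / (1 - s)))
          (A ** (mat_cpow (1 - s) (- (A + mat 1)) ** gauss_series X Q R (A + mat 1) (z / (1 - s)))) s"
        by (intro has_mat_deriv_cpow_gauss_series X) (auto simp: U_def \<rho>_def)
    qed
    show "g s = f s" if "s \<in> ball 0 (1 - norm z)" for s
    proof -
      have s: "norm z + norm s < 1" using that by simp
      have "(\<lambda>n. c n * s ^ n) sums f s"
        using cpow_gauss_series_taylor[OF X s, of A Q R]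
        by (simp add: matrix_sums_iff c_def f_def mult.commute)
      then show ?thesis by (simp add: g_def sums_iff)
    qed
    show "t \<in> U" using t zt by (simp add: U_def \<rho>_def)
  qed
  moreover have "(\<lambda>n. c n * t ^ n) sums g t"
    by (rule g_sums) (use t in \<open>simp add: \<rho>_def\<close>)
  ultimately show "(\<lambda>n. (mat (t ^ n / fact n) ** (mat_pochhammer A n ** gauss_series X Q R (A + mat (of_nat n)) z)) $ i $ j)
      sums (mat_cpow (1 - t) (- A) ** gauss_series X Q R A (z / (1 - t))) $ i $ j"
    by (simp add: c_def f_def mult.commute)
qed

lemma ext_Gauss_eq_gauss_series:
  "ext_Gauss X P Q R z =
     gauss_series X Q (R - Q) P z ** (mat_Gamma R ** matrix_inv (mat_Gamma Q) ** matrix_inv (mat_Gamma (R - Q)))"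
  by (simp add: ext_Gauss_def gauss_series_def matrix_mul_assoc)

theorem theorem5p1:
  fixes A B X :: "complex^'r^'r"
    and lam mu z t :: complex
  assumes "positive_stable A" and "positive_stable B" and "positive_stable X"
    and "B ** X = X ** B"
    and "Re mu > Re lam" and "Re lam > 0"
    and "norm z < norm (1 - t)"
    \<comment> \<open>Convergence conditions implicit in the formula: the series of the functions on the left
      has the open unit disc as its domain, and for fixed z the series in t has radius of
      convergence min 1 (norm (1 - z)).\<close>
    and "norm z < 1" and "norm t < 1" and "norm t < norm (1 - z)"
  shows "(\<lambda>n. mat (t ^ n / fact n) **
            (mat_pochhammer A n ** ext_Gauss X (A + mat (of_nat n)) B (B + mat (mu - lam)) z))
         sums (mat_cpow (1 - t) (- A) ** ext_Gauss X A B (B + mat (mu - lam)) (z / (1 - t)))"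
  unfolding ext_Gauss_eq_gauss_series matrix_mul_assoc
  using bounded_linear.sums[OF bounded_bilinear.bounded_linear_left[OF bounded_bilinear_matrix_mult]
      cpow_gauss_series_sums[OF assms(3,8,9,10,7), of A B "B + mat (mu - lam) - B"],
      of "mat_Gamma (B + mat (mu - lam)) ** matrix_inv (mat_Gamma B)
        ** matrix_inv (mat_Gamma (B + mat (mu - lam) - B))"]
  by (simp only: matrix_mul_assoc)

end
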